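(* Let $\Gamma$ be an additive subgroup of $\mathbb{R}$, let $E$ be a finite set, and let $\nu_{\mathsf{P}}\colon\Delta_E^r\to\overline{\Gamma}$ be an $M$-convex function of rank $r$ (a valuated discrete polymatroid $\mathsf{P}$). Define $\widetilde{\nu}_{\mathsf{P}}\colon\Delta_E^{\leq r}\to\overline{\Gamma}$ by $\widetilde{\nu}_{\mathsf{P}}(\alpha)=\min\{\nu_{\mathsf{P}}(\beta)\mid \beta\in\Delta_E^r,\ \alpha_e\leq\beta_e \text{ for all } e\in E\}$. Fix $0<q\leq 1$ and set $$I_k(\mathsf{P}):=\sum_{\alpha\in\Delta_E^k}\frac{q^{\widetilde{\nu}_{\mathsf{P}}(\alpha)}}{\alpha!}\qquad(0\leq k\leq r),$$ with the convention $q^\infty=0$. Then for all $1\leq k<r$, $$I_k(\mathsf{P})^2\ \geq\ \frac{k+1}{k}\, I_{k+1}(\mathsf{P})\, I_{k-1}(\mathsf{P}).$$ In particular the sequence $(I_k(\mathsf{P}))_k$ is log-concave.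
   Context: $\overline{\Gamma}=\Gamma\sqcup\{\infty\}$ with $\infty$ larger than every element of $\Gamma$. For $s\in E$, $e_s\in\mathbb{Z}^E$ is the standard basis vector. $\Delta_E^k=\{\alpha\in\mathbb{Z}_{\geq0}^E\mid \sum_{e\in E}\alpha_e=k\}$ and $\Delta_E^{\leq r}=\{\alpha\in\mathbb{Z}_{\ge0}^E\mid \sum_e\alpha_e\leq r\}$. For $\alpha\in\mathbb{Z}_{\ge0}^E$, $\alpha!=\prod_{e\in E}\alpha_e!$. An $M$-convex function of rank $r$ is a map $\nu\colon\Delta_E^r\to\overline{\Gamma}$, not identically $\infty$, such that for all $\alpha,\beta\in\Delta_E^r$ and every $s\in E$ with $\alpha_s>\beta_s$ there exists $t\in E$ with $\beta_t>\alpha_t$ and $\nu(\alpha)+\nu(\beta)\geq\nu(\alpha-e_s+e_t)+\nu(\beta-e_t+e_s)$. *)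

theory Defs
  imports Complex_Main "HOL-Library.Extended_Real"
begin

definition add_subgroup :: "real set \<Rightarrow> bool" where
  "add_subgroup G \<longleftrightarrow> 0 \<in> G \<and> (\<forall>x\<in>G. \<forall>y\<in>G. x + y \<in> G) \<and> (\<forall>x\<in>G. - x \<in> G)"

definition Delta :: "'e set \<Rightarrow> nat \<Rightarrow> ('e \<Rightarrow> nat) set" where
  "Delta E k = {\<alpha>. (\<forall>e. e \<notin> E \<longrightarrow> \<alpha> e = 0) \<and> (\<Sum>e\<in>E. \<alpha> e) = k}"

definition Delta_le :: "'e set \<Rightarrow> nat \<Rightarrow> ('e \<Rightarrow> nat) set" where
  "Delta_le E r = {\<alpha>. (\<forall>e. e \<notin> E \<longrightarrow> \<alpha> e = 0) \<and> (\<Sum>e\<in>E. \<alpha> e) \<le> r}"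

definition unitv :: "'e \<Rightarrow> 'e \<Rightarrow> nat" where
  "unitv s = (\<lambda>e. if e = s then 1 else 0)"

text \<open>M-convex function of rank r with values in Gamma-bar = Gamma \<union> {\<infinity>}, modelled in ereal.
  Only the values on Delta E r matter. Note alpha - e_s + e_t is computed pointwise in nat;
  since alpha_s > beta_s \<ge> 0 no truncation occurs.\<close>
definition M_convex :: "real set \<Rightarrow> 'e set \<Rightarrow> nat \<Rightarrow> (('e \<Rightarrow> nat) \<Rightarrow> ereal) \<Rightarrow> bool" where
  "M_convex G E r \<nu> \<longleftrightarrow>
     (\<forall>\<alpha>\<in>Delta E r. \<nu> \<alpha> = \<infinity> \<or> (\<exists>g\<in>G. \<nu> \<alpha> = ereal g)) \<and>
     (\<exists>\<alpha>\<in>Delta E r. \<nu> \<alpha> \<noteq> \<infinity>) \<and>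
     (\<forall>\<alpha>\<in>Delta E r. \<forall>\<beta>\<in>Delta E r. \<forall>s\<in>E. \<alpha> s > \<beta> s \<longrightarrow>
        (\<exists>t\<in>E. \<beta> t > \<alpha> t \<and>
           \<nu> \<alpha> + \<nu> \<beta> \<ge> \<nu> (\<lambda>e. \<alpha> e - unitv s e + unitv t e) + \<nu> (\<lambda>e. \<beta> e - unitv t e + unitv s e)))"

definition nu_tilde :: "'e set \<Rightarrow> nat \<Rightarrow> (('e \<Rightarrow> nat) \<Rightarrow> ereal) \<Rightarrow> ('e \<Rightarrow> nat) \<Rightarrow> ereal" where
  "nu_tilde E r \<nu> \<alpha> = Min {\<nu> \<beta> | \<beta>. \<beta> \<in> Delta E r \<and> (\<forall>e\<in>E. \<alpha> e \<le> \<beta> e)}"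

definition qpow :: "real \<Rightarrow> ereal \<Rightarrow> real" where
  "qpow q x = (if x = \<infinity> then 0 else q powr real_of_ereal x)"

definition I_seq :: "real \<Rightarrow> 'e set \<Rightarrow> nat \<Rightarrow> (('e \<Rightarrow> nat) \<Rightarrow> ereal) \<Rightarrow> nat \<Rightarrow> real" where
  "I_seq q E r \<nu> k = (\<Sum>\<alpha>\<in>Delta E k. qpow q (nu_tilde E r \<nu> \<alpha>) / (\<Prod>e\<in>E. fact (\<alpha> e)))"

end

theory Submission
  imports Defs "HOL-Analysis.Function_Topology"
begin

text \<open>Put \<open>a = q\<^sup>\<nu>\<close>, so that M-convexity becomes a multiplicative exchange property, and add a variable
  \<open>None\<close> carrying the missing degree; \<open>q\<close> to the power \<open>\<nu>\<close>-tilde then gives a function on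
  multi-indices of degree \<open>r\<close> which again has the exchange property. For a function with that property,
  the Hessian of the associated generating polynomial has at most one positive eigenvalue at every
  positive point. This is proved by induction on the degree: in degree two the exchange property is a
  four-point condition that reduces to positive semidefiniteness of ultrametric matrices, and the step is
  a trickle-down argument combining the Hessians of the partial derivatives. Apply this to the partial
  derivative of order \<open>r - k - 1\<close> in the new variable, in the direction of that variable and of the point
  itself, and let the new coordinate tend to \<open>0\<close> and the others be \<open>1\<close>.\<close>

section \<open>Lorentzian quadratic forms\<close>

text \<open>The weights \<open>1/\<alpha>!\<close> make differentiation a mere shift of the
  coefficients, so partial derivatives inherit the exchange property and the induction stays in one
  class of functions. They also produce the constant: the value in degree \<open>k\<close> is
  normalised by \<open>k!\<close>, and \<open>(k-1)! (k+1)! / (k!)^2 = (k+1)/k\<close>. The delicate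
  point is the exchange property after homogenization. A value there is a maximum over completions
  to degree \<open>r\<close>, and an exchange between two completed multi-indices may move a unit
  inside the completions instead of between the given indices. Choosing optimal completions with
  least excess rules out or reverses such moves.\<close>

definition bform :: "'i set \<Rightarrow> ('i \<Rightarrow> 'i \<Rightarrow> real) \<Rightarrow> ('i \<Rightarrow> real) \<Rightarrow> ('i \<Rightarrow> real) \<Rightarrow> real" where
  "bform I A x y = (\<Sum>i\<in>I. \<Sum>j\<in>I. x i * A i j * y j)"

text \<open>For symmetric \<open>A\<close> this reverse Cauchy-Schwarz inequality says that
  \<open>A\<close> has at most one positive eigenvalue; in this form it needs no spectral theory and
  applies directly to two chosen vectors.\<close>

definition lorentzian_form :: "'i set \<Rightarrow> ('i \<Rightarrow> 'i \<Rightarrow> real) \<Rightarrow> bool" where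
  "lorentzian_form I A \<longleftrightarrow>
     (\<forall>u v. bform I A u u > 0 \<longrightarrow> bform I A u u * bform I A v v \<le> (bform I A u v)\<^sup>2)"

definition symm_on :: "'i set \<Rightarrow> ('i \<Rightarrow> 'i \<Rightarrow> real) \<Rightarrow> bool" where
  "symm_on I A \<longleftrightarrow> (\<forall>i\<in>I. \<forall>j\<in>I. A i j = A j i)"

lemma symm_onD: "symm_on I A \<Longrightarrow> i \<in> I \<Longrightarrow> j \<in> I \<Longrightarrow> A i j = A j i"
  by (auto simp: symm_on_def)

lemma bform_row: "bform I A x y = (\<Sum>i\<in>I. x i * (\<Sum>j\<in>I. A i j * y j))"
  by (simp add: bform_def sum_distrib_left mult.assoc)

lemma bform_commute:
  assumes "symm_on I A"
  shows "bform I A x y = bform I A y x"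
proof -
  have "bform I A x y = (\<Sum>j\<in>I. \<Sum>i\<in>I. x i * A i j * y j)"
    unfolding bform_def by (rule sum.swap)
  also have "\<dots> = bform I A y x"
    unfolding bform_def
    by (intro sum.cong refl) (simp add: symm_onD[OF assms] mult.commute mult.left_commute)
  finally show ?thesis .
qed

lemma bform_add_scaled:
  assumes "symm_on I A"
  shows "bform I A (\<lambda>i. x i + t * y i) (\<lambda>i. x i + t * y i) =
    bform I A x x + 2 * t * bform I A x y + t\<^sup>2 * bform I A y y"
proof -
  have "bform I A (\<lambda>i. x i + t * y i) (\<lambda>i. x i + t * y i) =
    bform I A x x + t * bform I A x y + t * bform I A y x + t\<^sup>2 * bform I A y y"
    unfolding bform_def sum_distrib_left sum.distrib[symmetric]
    by (intro sum.cong refl) (simp add: algebra_simps power2_eq_square)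
  then show ?thesis by (simp add: bform_commute[OF assms, of y x])
qed

lemma bform_cong:
  "(\<And>i j. i \<in> I \<Longrightarrow> j \<in> I \<Longrightarrow> A i j = B i j) \<Longrightarrow> (\<And>i. i \<in> I \<Longrightarrow> x i = x' i) \<Longrightarrow>
   (\<And>i. i \<in> I \<Longrightarrow> y i = y' i) \<Longrightarrow> bform I A x y = bform I B x' y'"
  by (simp add: bform_def)

text \<open>A vector \<open>u\<close> of positive value lies off the hyperplane
  \<open>l = 0\<close>, so some \<open>v + t u\<close> lies on it. Nonpositivity there, multiplied
  by the value of \<open>u\<close> and completed to a square, gives the inequality.\<close>

lemma lorentzian_formI:
  assumes "symm_on I A"
    and neg: "\<And>x. (\<Sum>i\<in>I. l i * x i) = 0 \<Longrightarrow> bform I A x x \<le> 0"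
  shows "lorentzian_form I A"
  unfolding lorentzian_form_def
proof (intro allI impI)
  fix u v assume uu: "bform I A u u > 0"
  define L where "L x = (\<Sum>i\<in>I. l i * x i)" for x :: "'a \<Rightarrow> real"
  have "L u \<noteq> 0" using neg[of u] uu by (auto simp: L_def)
  define t where "t = - (L v / L u)"
  have "L (\<lambda>i. v i + t * u i) = L v + t * L u"
    by (simp add: L_def sum.distrib sum_distrib_left algebra_simps)
  also have "\<dots> = 0" using \<open>L u \<noteq> 0\<close> by (simp add: t_def)
  finally have "bform I A (\<lambda>i. v i + t * u i) (\<lambda>i. v i + t * u i) \<le> 0"
    using neg by (simp add: L_def)
  then have "bform I A v v + 2 * t * bform I A v u + t\<^sup>2 * bform I A u u \<le> 0"
    by (simp add: bform_add_scaled[OF assms(1)])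
  then have "bform I A u u * (bform I A v v + 2 * t * bform I A v u + t\<^sup>2 * bform I A u u) \<le> 0"
    using uu by (simp add: mult_le_0_iff)
  moreover have "0 \<le> (bform I A v u + t * bform I A u u)\<^sup>2" by simp
  ultimately show "bform I A u u * bform I A v v \<le> (bform I A u v)\<^sup>2"
    by (simp add: bform_commute[OF assms(1), of u v] algebra_simps power2_eq_square)
qed

section \<open>Maximisers of a quadratic form on a hyperplane\<close>

lemma psd_null_vector:
  fixes b c :: real
  assumes "\<And>t. 0 \<le> 2 * t * b + t\<^sup>2 * c"
  shows "b = 0"
proof (rule ccontr)
  assume "b \<noteq> 0"
  \<comment> \<open>At \<open>t = - s * b\<close> the quadratic equals
    \<open>s * b^2 * (s * c - 2)\<close>; this \<open>s\<close> makes it negative for either sign of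
    \<open>c\<close>.\<close>
  define s where "s = 1 / (1 + \<bar>c\<bar>)"
  have s: "0 < s" "s * \<bar>c\<bar> < 1" by (auto simp: s_def field_simps)
  have "0 \<le> 2 * (- s * b) * b + (- s * b)\<^sup>2 * c" by (rule assms)
  also have "\<dots> = s * b\<^sup>2 * (s * c - 2)" by (simp add: algebra_simps power2_eq_square)
  finally have "0 \<le> s * b\<^sup>2 * (s * c - 2)" .
  moreover have "s * c \<le> s * \<bar>c\<bar>" using s by (intro mult_left_mono) auto
  then have "s * c - 2 < 0" using s by linarith
  ultimately show False using s \<open>b \<noteq> 0\<close>
    by (smt (verit) mult_pos_neg mult_pos_pos zero_less_power2)
qed

text \<open>Stands in for the existence of a top eigenvector. The index type is arbitrary, so
  compactness comes from Tychonoff's theorem: the constraint set is closed in a product of intervals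
  that degenerate to \<open>{0}\<close> off \<open>J\<close>.\<close>

lemma compact_attains_max_quadratic:
  fixes I :: "'i set" and l c :: "'i \<Rightarrow> real"
  assumes I: "finite I" and J: "J \<subseteq> I" and c: "\<And>i. i \<in> J \<Longrightarrow> c i > 0"
  defines "K \<equiv> {x. (\<forall>i. i \<notin> J \<longrightarrow> x i = 0) \<and> (\<Sum>i\<in>I. l i * x i) = 0 \<and> (\<Sum>i\<in>J. c i * (x i)\<^sup>2) = 1}"
  assumes "K \<noteq> {}"
  obtains v where "v \<in> K" "\<And>x. x \<in> K \<Longrightarrow> bform I A x x \<le> bform I A v v"
proof -
  have finJ: "finite J" using I J finite_subset by auto
  \<comment> \<open>The constraint gives \<open>(x i)^2 \<le> 1 / c i\<close>. The bound covers both
    \<open>|x i| \<le> 1\<close> and \<open>|x i| \<le> (x i)^2\<close> without a square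
    root.\<close>
  define S where "S i = (if i \<in> J then {- (1 + 1 / c i)..1 + 1 / c i} else {0::real})" for i
  have comp: "compact (PiE UNIV S)"
  proof -
    have "compactin (product_topology (\<lambda>_. euclidean) UNIV) (PiE UNIV S)"
      by (simp add: compactin_PiE S_def)
    then show ?thesis by (simp add: euclidean_product_topology)
  qed
  have cont [continuous_intros]: "continuous_on X (\<lambda>x. x i)" for X :: "('i \<Rightarrow> real) set" and i
    by (rule continuous_on_subset[OF continuous_on_product_coordinates]) simp
  have cl1: "closed {x. (\<Sum>i\<in>I. l i * x i) = 0}"
    by (rule closed_Collect_eq) (intro continuous_intros)+
  have cl2: "closed {x. (\<Sum>i\<in>J. c i * (x i)\<^sup>2) = 1}"
    by (rule closed_Collect_eq) (intro continuous_intros)+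
  have "K = PiE UNIV S \<inter> ({x. (\<Sum>i\<in>I. l i * x i) = 0} \<inter> {x. (\<Sum>i\<in>J. c i * (x i)\<^sup>2) = 1})"
  proof (intro equalityI subsetI)
    fix x assume x: "x \<in> K"
    have "x i \<in> S i" for i
    proof (cases "i \<in> J")
      case True
      have "c i * (x i)\<^sup>2 \<le> (\<Sum>i\<in>J. c i * (x i)\<^sup>2)"
        using True c finJ by (intro member_le_sum) (auto simp: less_imp_le)
      also have "\<dots> = 1" using x by (simp add: K_def)
      finally have sq: "\<bar>x i\<bar> * \<bar>x i\<bar> \<le> 1 / c i"
        using c[OF True] by (simp add: field_simps power2_eq_square)
      have "\<bar>x i\<bar> \<le> 1 + 1 / c i"
      proof (cases "\<bar>x i\<bar> \<le> 1")
        case False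
        then have "\<bar>x i\<bar> * 1 \<le> \<bar>x i\<bar> * \<bar>x i\<bar>" by (intro mult_left_mono) auto
        then show ?thesis using sq by linarith
      qed (use c[OF True] in \<open>auto intro: add_increasing2\<close>)
      then show ?thesis using True by (auto simp: S_def)
    qed (use x in \<open>auto simp: K_def S_def\<close>)
    then show "x \<in> PiE UNIV S \<inter> ({x. (\<Sum>i\<in>I. l i * x i) = 0} \<inter> {x. (\<Sum>i\<in>J. c i * (x i)\<^sup>2) = 1})"
      using x by (auto simp: K_def)
  next
    fix x assume x: "x \<in> PiE UNIV S \<inter> ({x. (\<Sum>i\<in>I. l i * x i) = 0} \<inter> {x. (\<Sum>i\<in>J. c i * (x i)\<^sup>2) = 1})"
    have "x i = 0" if "i \<notin> J" for i
      using x that by (auto simp: PiE_UNIV_domain Pi_iff S_def split: if_splits)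
    then show "x \<in> K" using x by (auto simp: K_def)
  qed
  then have "compact K" using comp cl1 cl2 by (simp add: compact_Int_closed closed_Int)
  moreover have "continuous_on K (\<lambda>x. bform I A x x)"
    unfolding bform_def by (intro continuous_intros)
  ultimately show thesis
    using continuous_attains_sup[of K "\<lambda>x. bform I A x x"] \<open>K \<noteq> {}\<close> that by blast
qed

text \<open>With the inner product weighted by \<open>p\<^sub>i / w\<^sub>i\<close>, the operator \<open>v \<mapsto> (w\<^sub>i (A v)\<^sub>i / p\<^sub>i)\<close> is
  self-adjoint, fixes \<open>w\<close>, and by \<open>bound\<close> has no eigenvalue strictly between \<open>0\<close> and \<open>1\<close>.
  A Perron--Frobenius argument shows that the eigenvalue \<open>1\<close> is simple and largest, so the form is
  nonpositive on the orthogonal complement of \<open>w\<close>. Indices with \<open>p i = 0\<close> contribute \<open>0\<close> to the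
  right-hand side of \<open>bound\<close> by \<open>x / 0 = 0\<close>.\<close>
lemma lorentzian_form_trickle_down:
  fixes I :: "'i set" and w :: "'i \<Rightarrow> real"
  assumes I: "finite I" and sym: "symm_on I A"
    and nonneg: "\<And>i j. i \<in> I \<Longrightarrow> j \<in> I \<Longrightarrow> A i j \<ge> 0"
    and w: "\<And>i. i \<in> I \<Longrightarrow> w i > 0"
    and p: "\<And>i. i \<in> I \<Longrightarrow> p i = (\<Sum>j\<in>I. A i j * w j)"
    and bound: "\<And>v. bform I A v v \<le> (\<Sum>i\<in>I. w i * (\<Sum>j\<in>I. A i j * v j)\<^sup>2 / p i)"
    and conn: "\<And>i j. i \<in> I \<Longrightarrow> j \<in> I \<Longrightarrow> p i > 0 \<Longrightarrow> p j > 0 \<Longrightarrow>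
      A i j > 0 \<or> (\<exists>k\<in>I. A i k > 0 \<and> A k j > 0)"
  shows "lorentzian_form I A"
proof (rule lorentzian_formI[where l = p, OF sym], rule ccontr)
  fix x assume x0: "(\<Sum>i\<in>I. p i * x i) = 0" and "\<not> bform I A x x \<le> 0"
  then have xpos: "bform I A x x > 0" by simp
  \<comment> \<open>Indices with \<open>p i = 0\<close> have zero rows and columns, so only
    \<open>J\<close> matters; there the weights \<open>c\<close> are positive and \<open>N\<close>
    is the square of a norm.\<close>
  define J where "J = {i\<in>I. p i > 0}"
  define c where "c i = p i / w i" for i
  have J: "J \<subseteq> I" "finite J" using I by (auto simp: J_def)
  have c: "c i > 0" if "i \<in> J" for i using that w by (auto simp: J_def c_def)
  have p0: "p i \<ge> 0" if "i \<in> I" for i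
    using that nonneg w p by (auto intro!: sum_nonneg mult_nonneg_nonneg simp: less_imp_le)
  have pJ: "p i = 0" if "i \<in> I - J" for i using p0[of i] that by (auto simp: J_def)
  have A0: "A i j = 0 \<and> A j i = 0" if "i \<in> I - J" "j \<in> I" for i j
  proof -
    have "(\<Sum>j\<in>I. A i j * w j) = 0" using pJ[OF that(1)] p that by auto
    then have "\<forall>j\<in>I. A i j * w j = 0"
      using that nonneg w by (subst (asm) sum_nonneg_eq_0_iff[OF I]) (auto simp: less_imp_le)
    then show ?thesis using that w[of j] symm_onD[OF sym, of i j] by force
  qed
  define N where "N y = (\<Sum>i\<in>J. c i * (y i)\<^sup>2)" for y
  have N0: "N y \<ge> 0" for y unfolding N_def using c by (intro sum_nonneg) (auto simp: less_imp_le)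
  have sumJ: "(\<Sum>i\<in>I. p i * y i) = (\<Sum>i\<in>J. p i * y i)" for y
    using J I pJ by (intro sum.mono_neutral_right) auto
  have bJ: "bform I A y z = bform I A y' z'" if "\<And>i. i \<in> J \<Longrightarrow> y i = y' i" "\<And>i. i \<in> J \<Longrightarrow> z i = z' i" for y z y' z'
    unfolding bform_def
  proof (intro sum.cong refl)
    fix i j assume ij: "i \<in> I" "j \<in> I"
    show "y i * A i j * z j = y' i * A i j * z' j"
      using that A0 ij by (cases "i \<in> J"; cases "j \<in> J") auto
  qed
  have bscale: "bform I A (\<lambda>i. y i / s) (\<lambda>i. y i / s) = bform I A y y / s\<^sup>2" for y s
    unfolding bform_def sum_divide_distrib by (simp add: power2_eq_square field_simps)
  have N_zero: "bform I A y z = 0" if "N y = 0" for y z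
  proof -
    have "\<forall>i\<in>J. c i * (y i)\<^sup>2 = 0"
      using that c unfolding N_def by (subst (asm) sum_nonneg_eq_0_iff[OF J(2)]) (auto simp: less_imp_le)
    then have "\<And>i. i \<in> J \<Longrightarrow> y i = 0" using c by force
    then have "bform I A y z = bform I A (\<lambda>_. 0) z" by (intro bJ) auto
    then show ?thesis by (simp add: bform_def)
  qed
  define K where "K = {x. (\<forall>i. i \<notin> J \<longrightarrow> x i = 0) \<and> (\<Sum>i\<in>I. p i * x i) = 0 \<and> (\<Sum>i\<in>J. c i * (x i)\<^sup>2) = 1}"
  define nrm where "nrm y = (\<lambda>i. (if i \<in> J then y i else 0) / sqrt (N y))" for y
  have nrm: "nrm y \<in> K \<and> bform I A (nrm y) (nrm y) = bform I A y y / N y"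
    if "(\<Sum>i\<in>I. p i * y i) = 0" "N y \<noteq> 0" for y
  proof -
    have "N y > 0" using N0[of y] that by linarith
    have "(\<Sum>i\<in>I. p i * nrm y i) = (\<Sum>i\<in>J. p i * y i) / sqrt (N y)"
      unfolding sumJ sum_divide_distrib by (intro sum.cong) (auto simp: nrm_def)
    then have "(\<Sum>i\<in>I. p i * nrm y i) = 0" using that sumJ[of y] by simp
    moreover have "(\<Sum>i\<in>J. c i * (nrm y i)\<^sup>2) = N y / (sqrt (N y))\<^sup>2"
      unfolding sum_divide_distrib N_def by (intro sum.cong) (auto simp: nrm_def N_def power_divide)
    then have "(\<Sum>i\<in>J. c i * (nrm y i)\<^sup>2) = 1" using \<open>N y > 0\<close> by simp
    moreover have "bform I A (nrm y) (nrm y) = bform I A (\<lambda>i. if i \<in> J then y i else 0) (\<lambda>i. if i \<in> J then y i else 0) / (sqrt (N y))\<^sup>2"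
      unfolding nrm_def by (rule bscale)
    moreover have "bform I A (\<lambda>i. if i \<in> J then y i else 0) (\<lambda>i. if i \<in> J then y i else 0) = bform I A y y"
      by (intro bJ) auto
    ultimately show ?thesis using \<open>N y > 0\<close> by (auto simp: K_def nrm_def)
  qed
  have Nx: "N x \<noteq> 0" using N_zero xpos by force
  then have "K \<noteq> {}" using nrm[OF x0] by auto
  then obtain v where vK: "v \<in> K" and vmax: "\<And>y. y \<in> K \<Longrightarrow> bform I A y y \<le> bform I A v v"
    using compact_attains_max_quadratic[OF I J(1), of c p A] c unfolding K_def by blast
  define \<mu> where "\<mu> = bform I A v v"
  have v0: "\<And>i. i \<notin> J \<Longrightarrow> v i = 0" and pv: "(\<Sum>i\<in>I. p i * v i) = 0" and Nv: "N v = 1"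
    using vK by (auto simp: K_def N_def)
  have "bform I A x x / N x \<le> \<mu>" using vmax[of "nrm x"] nrm[OF x0 Nx] by (simp add: \<mu>_def)
  then have mu0: "\<mu> > 0" using xpos N0[of x] Nx by (smt (verit) divide_pos_pos)
  have le: "bform I A y y \<le> \<mu> * N y" if "(\<Sum>i\<in>I. p i * y i) = 0" for y
  proof (cases "N y = 0")
    case False
    then have "bform I A y y / N y \<le> \<mu>" using vmax[of "nrm y"] nrm[OF that] by (simp add: \<mu>_def)
    then show ?thesis using False N0[of y] by (simp add: divide_le_eq)
  qed (use N_zero[of y y] in simp)
  have N_add: "N (\<lambda>i. v i + t * y i) = N v + 2 * t * (\<Sum>i\<in>J. c i * v i * y i) + t\<^sup>2 * N y" for t y
    unfolding N_def sum_distrib_left sum.distrib[symmetric]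
    by (intro sum.cong refl) (simp add: algebra_simps power2_eq_square)
  \<comment> \<open>By maximality \<open>\<mu> * N - bform\<close> is nonnegative on the hyperplane
    and zero at \<open>v\<close>, so its first-order term along \<open>y\<close> vanishes.\<close>
  have stat0: "bform I A v y = \<mu> * (\<Sum>i\<in>J. c i * v i * y i)" if y: "(\<Sum>i\<in>I. p i * y i) = 0" for y
  proof -
    have "\<mu> * (\<Sum>i\<in>J. c i * v i * y i) - bform I A v y = 0"
    proof (rule psd_null_vector[where c = "\<mu> * N y - bform I A y y"])
      fix t
      have "(\<Sum>i\<in>I. p i * (v i + t * y i)) = (\<Sum>i\<in>I. p i * v i) + t * (\<Sum>i\<in>I. p i * y i)"
        by (simp add: sum.distrib sum_distrib_left algebra_simps)
      then have "bform I A (\<lambda>i. v i + t * y i) (\<lambda>i. v i + t * y i) \<le> \<mu> * N (\<lambda>i. v i + t * y i)"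
        using le pv y by simp
      then show "0 \<le> 2 * t * (\<mu> * (\<Sum>i\<in>J. c i * v i * y i) - bform I A v y) + t\<^sup>2 * (\<mu> * N y - bform I A y y)"
        unfolding bform_add_scaled[OF sym] N_add using Nv by (simp add: \<mu>_def algebra_simps)
    qed
    then show ?thesis by simp
  qed
  have vw: "bform I A v w = 0" using pv p by (simp add: bform_row mult.commute)
  have cw: "(\<Sum>i\<in>J. c i * v i * w i) = 0"
  proof -
    have "(\<Sum>i\<in>J. c i * v i * w i) = (\<Sum>i\<in>J. p i * v i)"
      using J w by (intro sum.cong refl) (force simp: c_def)
    then show ?thesis using pv sumJ[of v] by simp
  qed
  have pw: "(\<Sum>i\<in>I. p i * w i) > 0"
  proof -
    have "J \<noteq> {}" using Nv by (auto simp: N_def)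
    then show ?thesis unfolding sumJ using J w by (intro sum_pos) (auto simp: J_def)
  qed
  \<comment> \<open>Both sides vanish at \<open>y = w\<close>, and \<open>w\<close> is transversal
    to the hyperplane, so stationarity extends to all directions and becomes an eigenvalue
    equation.\<close>
  have stat: "bform I A v y = \<mu> * (\<Sum>i\<in>J. c i * v i * y i)" for y
  proof -
    define t where "t = (\<Sum>i\<in>I. p i * y i) / (\<Sum>i\<in>I. p i * w i)"
    have "(\<Sum>i\<in>I. p i * (y i - t * w i)) = (\<Sum>i\<in>I. p i * y i) - t * (\<Sum>i\<in>I. p i * w i)"
      by (simp add: sum_subtractf sum_distrib_left algebra_simps)
    also have "\<dots> = 0" using pw by (simp add: t_def)
    finally have "bform I A v (\<lambda>i. y i - t * w i) = \<mu> * (\<Sum>i\<in>J. c i * v i * (y i - t * w i))"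
      by (rule stat0)
    moreover have "bform I A v (\<lambda>i. y i - t * w i) = bform I A v y - t * bform I A v w"
      unfolding bform_def by (simp add: sum_subtractf sum_distrib_left algebra_simps)
    moreover have "(\<Sum>i\<in>J. c i * v i * (y i - t * w i)) = (\<Sum>i\<in>J. c i * v i * y i) - t * (\<Sum>i\<in>J. c i * v i * w i)"
      by (simp add: sum_subtractf sum_distrib_left algebra_simps)
    ultimately show ?thesis using vw cw by simp
  qed
  have eigen: "(\<Sum>j\<in>I. A i j * v j) = \<mu> * c i * v i" if i: "i \<in> I" for i
  proof (cases "i \<in> J")
    case True
    define y where "y j = (if j = i then 1 else 0 :: real)" for j
    have "bform I A v y = bform I A y v" by (rule bform_commute[OF sym])
    also have "\<dots> = (\<Sum>k\<in>I. if k = i then \<Sum>j\<in>I. A i j * v j else 0)"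
      unfolding bform_row y_def by (intro sum.cong) auto
    also have "\<dots> = (\<Sum>j\<in>I. A i j * v j)" using i I by simp
    finally have "(\<Sum>j\<in>I. A i j * v j) = \<mu> * (\<Sum>k\<in>J. c k * v k * y k)" using stat[of y] by simp
    also have "(\<Sum>k\<in>J. c k * v k * y k) = (\<Sum>k\<in>J. if k = i then c i * v i else 0)"
      unfolding y_def by (intro sum.cong) auto
    also have "\<dots> = c i * v i" using True J by simp
    finally show ?thesis by simp
  qed (use i A0 v0 in auto)
  \<comment> \<open>On the eigenvector the right-hand side of \<open>bound\<close> collapses to
    \<open>\<mu>^2 * N v\<close>; as \<open>\<mu> > 0\<close>, this forces
    \<open>\<mu> \<ge> 1\<close>.\<close>
  have "\<mu> \<le> \<mu>\<^sup>2"
  proof -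
    have "\<mu> \<le> (\<Sum>i\<in>I. w i * (\<mu> * c i * v i)\<^sup>2 / p i)"
      using bound[of v] eigen by (simp add: \<mu>_def)
    also have "\<dots> = (\<Sum>i\<in>J. w i * (\<mu> * c i * v i)\<^sup>2 / p i)"
      using J I v0 by (intro sum.mono_neutral_right) auto
    also have "\<dots> = (\<Sum>i\<in>J. \<mu>\<^sup>2 * (c i * (v i)\<^sup>2))"
    proof (intro sum.cong refl)
      fix i assume "i \<in> J"
      then have "w i > 0" "p i > 0" using w J by (auto simp: J_def)
      then show "w i * (\<mu> * c i * v i)\<^sup>2 / p i = \<mu>\<^sup>2 * (c i * (v i)\<^sup>2)"
        by (simp add: c_def field_simps power2_eq_square)
    qed
    also have "\<dots> = \<mu>\<^sup>2 * N v" by (simp add: N_def sum_distrib_left)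
    finally show ?thesis using Nv by simp
  qed
  then have mu1: "\<mu> \<ge> 1" using mu0 by (simp add: power2_eq_square)
  \<comment> \<open>The defect in the triangle inequality, row by row. Pairing it with
    \<open>w\<close> and using \<open>A w = p\<close> gives \<open>1 - \<mu>\<close> times a
    nonnegative sum, so every defect vanishes: no row of \<open>A\<close> sees entries of
    \<open>v\<close> with opposite signs.\<close>
  define d where "d i = (\<Sum>j\<in>I. A i j * \<bar>v j\<bar>) - \<bar>\<Sum>j\<in>I. A i j * v j\<bar>" for i
  have d0: "d i \<ge> 0" if "i \<in> I" for i
  proof -
    have "\<bar>\<Sum>j\<in>I. A i j * v j\<bar> \<le> (\<Sum>j\<in>I. \<bar>A i j * v j\<bar>)" by (rule sum_abs)
    also have "\<dots> = (\<Sum>j\<in>I. A i j * \<bar>v j\<bar>)" using nonneg that by (intro sum.cong) (auto simp: abs_mult)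
    finally show ?thesis by (simp add: d_def)
  qed
  have "(\<Sum>i\<in>I. w i * d i) = (\<Sum>i\<in>I. \<Sum>j\<in>I. w i * A i j * \<bar>v j\<bar>) - (\<Sum>i\<in>I. w i * \<bar>\<Sum>j\<in>I. A i j * v j\<bar>)"
    unfolding d_def by (simp add: right_diff_distrib sum_subtractf sum_distrib_left mult.assoc)
  also have "(\<Sum>i\<in>I. \<Sum>j\<in>I. w i * A i j * \<bar>v j\<bar>) = (\<Sum>j\<in>I. p j * \<bar>v j\<bar>)"
  proof (subst sum.swap, intro sum.cong refl)
    fix j assume j: "j \<in> I"
    show "(\<Sum>i\<in>I. w i * A i j * \<bar>v j\<bar>) = p j * \<bar>v j\<bar>"
      unfolding p[OF j] sum_distrib_right
      by (intro sum.cong refl) (use symm_onD[OF sym _ j] in simp)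
  qed
  also have "(\<Sum>i\<in>I. w i * \<bar>\<Sum>j\<in>I. A i j * v j\<bar>) = \<mu> * (\<Sum>i\<in>I. p i * \<bar>v i\<bar>)"
    unfolding sum_distrib_left
  proof (intro sum.cong refl)
    fix i assume i: "i \<in> I"
    then have "w i > 0" "p i \<ge> 0" using w p0 by auto
    then show "w i * \<bar>\<Sum>j\<in>I. A i j * v j\<bar> = \<mu> * (p i * \<bar>v i\<bar>)"
      unfolding eigen[OF i] using mu0 by (simp add: c_def abs_mult)
  qed
  finally have "(\<Sum>i\<in>I. w i * d i) = (1 - \<mu>) * (\<Sum>i\<in>I. p i * \<bar>v i\<bar>)" by (simp add: algebra_simps)
  moreover have "(\<Sum>i\<in>I. p i * \<bar>v i\<bar>) \<ge> 0" using p0 by (intro sum_nonneg) auto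
  ultimately have "(\<Sum>i\<in>I. w i * d i) \<le> 0" using mu1 by (simp add: mult_nonpos_nonneg)
  moreover have "\<And>i. i \<in> I \<Longrightarrow> w i * d i \<ge> 0" using w d0 by (simp add: less_imp_le)
  ultimately have "\<forall>i\<in>I. w i * d i = 0"
    using sum_nonneg_eq_0_iff[OF I, of "\<lambda>i. w i * d i"] sum_nonneg[of I "\<lambda>i. w i * d i"] by fastforce
  then have dz: "d i = 0" if "i \<in> I" for i using w that by fastforce
  have signs: "((\<forall>j\<in>I. A k j > 0 \<longrightarrow> v j \<ge> 0) \<and> (\<Sum>j\<in>I. A k j * v j) \<ge> 0) \<or>
      ((\<forall>j\<in>I. A k j > 0 \<longrightarrow> v j \<le> 0) \<and> (\<Sum>j\<in>I. A k j * v j) < 0)" if k: "k \<in> I" for k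
  proof -
    have *: "\<forall>j\<in>I. A k j > 0 \<longrightarrow> \<bar>v j\<bar> = s * v j"
      if s: "s = 1 \<or> s = -1" and eq: "\<bar>\<Sum>j\<in>I. A k j * v j\<bar> = s * (\<Sum>j\<in>I. A k j * v j)" for s
    proof -
      have "(\<Sum>j\<in>I. A k j * (\<bar>v j\<bar> - s * v j)) = 0"
        using dz[OF k] eq by (simp add: d_def right_diff_distrib sum_subtractf sum_distrib_left mult_ac)
      then have "\<forall>j\<in>I. A k j * (\<bar>v j\<bar> - s * v j) = 0"
        using s nonneg[OF k] by (subst (asm) sum_nonneg_eq_0_iff[OF I]) (auto intro!: mult_nonneg_nonneg)
      then show ?thesis by force
    qed
    show ?thesis
    proof (cases "(\<Sum>j\<in>I. A k j * v j) \<ge> 0")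
      case True then show ?thesis using *[of 1] by force
    next
      case False then show ?thesis using *[of "-1"] by force
    qed
  qed
  \<comment> \<open>\<open>v\<close> is nonzero on \<open>J\<close> and its
    \<open>p\<close>-weighted sum is zero, so it takes both signs; \<open>conn\<close> then produces
    a row violating \<open>signs\<close>.\<close>
  have ex: "\<exists>i\<in>J. s * v i > 0" if s: "s = 1 \<or> s = -1" for s
  proof (rule ccontr)
    assume "\<not> ?thesis"
    then have n: "\<And>i. i \<in> J \<Longrightarrow> 0 \<le> - (s * v i)" by force
    have "(\<Sum>i\<in>J. p i * - (s * v i)) = - s * (\<Sum>i\<in>J. p i * v i)"
      by (simp add: sum_distrib_left algebra_simps)
    then have "(\<Sum>i\<in>J. p i * - (s * v i)) = 0" using pv sumJ[of v] by simp
    then have "\<forall>i\<in>J. p i * - (s * v i) = 0"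
      by (subst (asm) sum_nonneg_eq_0_iff[OF J(2)])
         (intro mult_nonneg_nonneg n, auto simp: J_def)
    then have "\<forall>i\<in>J. v i = 0" using s by (auto simp: J_def)
    then show False using Nv by (simp add: N_def)
  qed
  obtain i where i: "i \<in> J" "v i > 0" using ex[of 1] by auto
  obtain j where j: "j \<in> J" "v j < 0" using ex[of "-1"] by auto
  have iI: "i \<in> I" "j \<in> I" and pij: "p i > 0" "p j > 0" using i j by (auto simp: J_def)
  from conn[OF iI pij] show False
  proof
    assume "A i j > 0"
    moreover have "(\<Sum>j\<in>I. A i j * v j) > 0"
      using eigen[OF iI(1)] mu0 c[OF i(1)] i by simp
    ultimately show False using signs[OF iI(1)] iI j by force
  next
    assume "\<exists>k\<in>I. A i k > 0 \<and> A k j > 0"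
    then obtain k where "k \<in> I" "A k i > 0" "A k j > 0"
      using symm_onD[OF sym] iI by metis
    then show False using signs[of k] iI i j by force
  qed
qed

section \<open>Ultrametric matrices and the four-point condition\<close>

lemma bform_insert:
  assumes "finite R" "b \<notin> R" "symm_on (insert b R) A"
  shows "bform (insert b R) A x x = bform R A x x + 2 * x b * (\<Sum>j\<in>R. A b j * x j) + A b b * (x b)\<^sup>2"
proof -
  have "(\<Sum>i\<in>R. x i * A i b * x b) = x b * (\<Sum>j\<in>R. A b j * x j)"
    unfolding sum_distrib_left
    by (intro sum.cong refl) (use symm_onD[OF assms(3), of _ b] in auto)
  then show ?thesis
    using assms(1,2) by (simp add: bform_def sum.distrib sum_distrib_left power2_eq_square algebra_simps)
qed

text \<open>Two indices at maximal similarity have equal rows outside themselves and can be merged.\<close>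
lemma ultrametric_psd:
  assumes "finite Q" "symm_on Q s"
    and "\<And>i j. i \<in> Q \<Longrightarrow> j \<in> Q \<Longrightarrow> 0 \<le> s i j"
    and "\<And>i j l. i \<in> Q \<Longrightarrow> j \<in> Q \<Longrightarrow> l \<in> Q \<Longrightarrow> min (s i l) (s l j) \<le> s i j"
  shows "0 \<le> bform Q s x x"
  using assms
proof (induction "card Q" arbitrary: Q s x rule: less_induct)
  case less
  show ?case
  proof (cases "\<exists>a\<in>Q. \<exists>b\<in>Q. a \<noteq> b")
    case False
    then consider "Q = {}" | i where "Q = {i}" by blast
    then show ?thesis
    proof cases
      case 2
      then have "bform Q s x x = s i i * (x i)\<^sup>2" by (simp add: bform_def power2_eq_square)
      then show ?thesis using less.prems(3)[of i i] 2 by simp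
    qed (simp add: bform_def)
  next
    case True
    define Z where "Z = {(a, b) \<in> Q \<times> Q. a \<noteq> b}"
    have "finite Z" using less.prems(1) finite_subset[of Z "Q \<times> Q"] by (auto simp: Z_def)
    moreover have "Z \<noteq> {}" using True by (auto simp: Z_def)
    ultimately have "Max (case_prod s ` Z) \<in> case_prod s ` Z" by (intro Max_in) auto
    then obtain z where z: "z \<in> Z" "Max (case_prod s ` Z) = case_prod s z" by auto
    have zmax: "case_prod s y \<le> case_prod s z" if "y \<in> Z" for y
      unfolding z(2)[symmetric] using that \<open>finite Z\<close> by (intro Max_ge) auto
    obtain a b where ab: "z = (a, b)" "a \<in> Q" "b \<in> Q" "a \<noteq> b" using z by (auto simp: Z_def)
    have mx: "s i j \<le> s a b" if "i \<in> Q" "j \<in> Q" "i \<noteq> j" for i j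
      using zmax[of "(i, j)"] that ab by (auto simp: Z_def)
    define T where "T = Q - {a, b}"
    have Q: "Q = insert b (insert a T)" "finite T" "a \<notin> T" "b \<notin> insert a T"
      using ab less.prems(1) by (auto simp: T_def)
    have sym: "\<And>i j. i \<in> Q \<Longrightarrow> j \<in> Q \<Longrightarrow> s i j = s j i" using less.prems(2) by (rule symm_onD)
    have row: "s b j = s a j" if "j \<in> T" for j
    proof -
      have j: "j \<in> Q" "j \<noteq> a" "j \<noteq> b" using that by (auto simp: T_def)
      have "s a j \<le> s b j" "s b j \<le> s a j"
        using less.prems(4)[of b j a] less.prems(4)[of a j b] mx[of a j] mx[of b j] sym[of a b] ab j
        by (auto simp: min_def split: if_splits)
      then show ?thesis by simp
    qed
    \<comment> \<open>The merged index gets self-similarity \<open>s a b\<close>; maximality of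
      \<open>s a b\<close> off the diagonal preserves the ultrametric inequality. The original form
      exceeds the merged one by
      \<open>(s a a - s a b) * (x a)^2 + (s b b - s a b) * (x b)^2\<close>, which is
      nonnegative.\<close>
    define s' where "s' i j = (if i = a \<and> j = a then s a b else s i j)" for i j
    have sub: "insert a T \<subseteq> Q" using Q by auto
    have s'sym: "symm_on (insert a T) s'"
      unfolding symm_on_def s'_def using sym sub by auto
    have "0 \<le> bform (insert a T) s' (x(a := x a + x b)) (x(a := x a + x b))"
    proof (rule less.hyps)
      show "card (insert a T) < card Q" using Q by simp
      show "finite (insert a T)" using Q by simp
      show "symm_on (insert a T) s'" by (rule s'sym)
      show "0 \<le> s' i j" if "i \<in> insert a T" "j \<in> insert a T" for i j
        using that sub less.prems(3) ab by (auto simp: s'_def)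
      show "min (s' i l) (s' l j) \<le> s' i j" if ijl: "i \<in> insert a T" "j \<in> insert a T" "l \<in> insert a T" for i j l
      proof -
        have "i \<in> Q" "j \<in> Q" "l \<in> Q" using ijl sub by auto
        then show ?thesis
          using less.prems(4)[of i j l] mx[of a l] ab
          by (cases "i = a"; cases "j = a"; cases "l = a") (auto simp: s'_def)
      qed
    qed
    also have "bform (insert a T) s' (x(a := x a + x b)) (x(a := x a + x b)) =
      bform T s x x + 2 * (x a + x b) * (\<Sum>j\<in>T. s a j * x j) + s a b * (x a + x b)\<^sup>2"
    proof -
      have "bform T s' (x(a := x a + x b)) (x(a := x a + x b)) = bform T s x x"
        using Q by (intro bform_cong) (auto simp: s'_def)
      moreover have "(\<Sum>j\<in>T. s' a j * (x(a := x a + x b)) j) = (\<Sum>j\<in>T. s a j * x j)"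
        using Q by (intro sum.cong) (auto simp: s'_def)
      ultimately show ?thesis
        unfolding bform_insert[OF Q(2,3) s'sym] by (simp add: s'_def)
    qed
    finally have ih: "0 \<le> bform T s x x + 2 * (x a + x b) * (\<Sum>j\<in>T. s a j * x j) + s a b * (x a + x b)\<^sup>2" .
    have symaT: "symm_on (insert a T) s" unfolding symm_on_def using sym sub by auto
    have "bform Q s x x = bform T s x x + 2 * x a * (\<Sum>j\<in>T. s a j * x j) + s a a * (x a)\<^sup>2
        + 2 * x b * (\<Sum>j\<in>insert a T. s b j * x j) + s b b * (x b)\<^sup>2"
      using bform_insert[of "insert a T" b s x] bform_insert[OF Q(2,3) symaT] Q less.prems(2) by simp
    also have "(\<Sum>j\<in>insert a T. s b j * x j) = s a b * x a + (\<Sum>j\<in>T. s a j * x j)"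
      using Q row sym[of a b] ab by simp
    finally have "bform Q s x x =
      (bform T s x x + 2 * (x a + x b) * (\<Sum>j\<in>T. s a j * x j) + s a b * (x a + x b)\<^sup>2)
      + (s a a - s a b) * (x a)\<^sup>2 + (s b b - s a b) * (x b)\<^sup>2"
      by (simp add: algebra_simps power2_eq_square)
    moreover have "s a b \<le> s a a" "s a b \<le> s b b"
      using less.prems(4)[of a a b] less.prems(4)[of b b a] sym[of a b] ab by auto
    ultimately show ?thesis using ih by simp
  qed
qed

text \<open>Dividing by a nonzero row \<open>a = A z\<close> turns the four-point condition into an ultrametric inequality on
  the support of \<open>a\<close>; the rows outside the support are proportional to \<open>a\<close>, so they do not matter on
  the hyperplane orthogonal to \<open>a\<close>.\<close>
lemma lorentzian_form_four_point:
  assumes I: "finite I" and sym: "symm_on I A"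
    and nonneg: "\<And>i j. i \<in> I \<Longrightarrow> j \<in> I \<Longrightarrow> A i j \<ge> 0"
    and four: "\<And>i j k l. i \<in> I \<Longrightarrow> j \<in> I \<Longrightarrow> k \<in> I \<Longrightarrow> l \<in> I \<Longrightarrow>
      A i j * A k l \<le> max (A i k * A j l) (A i l * A j k)"
  shows "lorentzian_form I A"
proof (cases "\<exists>z\<in>I. \<exists>m\<in>I. A z m \<noteq> 0")
  case False
  then have "bform I A x y = 0" for x y by (simp add: bform_def)
  then show ?thesis by (simp add: lorentzian_form_def)
next
  case True
  then obtain z m where zm: "z \<in> I" "m \<in> I" "A z m > 0" using nonneg by force
  have symD: "\<And>i j. i \<in> I \<Longrightarrow> j \<in> I \<Longrightarrow> A i j = A j i" using sym by (rule symm_onD)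
  define a where "a i = A z i" for i
  define Q where "Q = {i\<in>I. a i > 0}"
  have Q: "finite Q" "Q \<subseteq> I" using I by (auto simp: Q_def)
  have a0: "a i \<ge> 0" if "i \<in> I" for i using nonneg zm that by (simp add: a_def)
  have aP: "a i = 0" if "i \<in> I - Q" for i using a0[of i] that by (auto simp: Q_def)
  define c where "c j = A j m / a m" for j
  \<comment> \<open>As \<open>A j z = 0\<close>, one product in each maximum vanishes; the
    four-point condition used in both directions leaves
    \<open>A j k * A z m = A j m * A z k\<close>.\<close>
  have propor: "A j k = c j * a k" if jk: "j \<in> I - Q" "k \<in> I" for j k
  proof -
    have zero: "A j z = 0" using aP[OF jk(1)] symD[of j z] jk zm by (simp add: a_def)
    have "A j k * a m \<le> A j m * a k"
      using four[of j k z m] jk zm zero symD[of k z] nonneg[of j m] nonneg[of z k]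
      by (simp add: a_def)
    moreover have "A j m * a k \<le> A j k * a m"
      using four[of j m z k] jk zm zero symD[of m z] nonneg[of j k] nonneg[of z m]
      by (simp add: a_def)
    ultimately show ?thesis using zm by (simp add: c_def a_def field_simps)
  qed
  show ?thesis
  proof (rule lorentzian_formI[where l = a, OF sym])
    fix x assume x0: "(\<Sum>i\<in>I. a i * x i) = 0"
    have row0: "(\<Sum>k\<in>I. A j k * x k) = 0" if j: "j \<in> I - Q" for j
    proof -
      have "(\<Sum>k\<in>I. A j k * x k) = c j * (\<Sum>k\<in>I. a k * x k)"
        unfolding sum_distrib_left by (intro sum.cong refl) (simp add: propor[OF j])
      then show ?thesis using x0 by simp
    qed
    have "bform I A x x = (\<Sum>i\<in>Q. x i * (\<Sum>j\<in>I. A i j * x j))"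
      unfolding bform_row using I Q row0 by (intro sum.mono_neutral_right) auto
    also have "\<dots> = (\<Sum>j\<in>I. \<Sum>i\<in>Q. x i * A i j * x j)"
      unfolding sum_distrib_left by (subst sum.swap) (simp add: mult.assoc)
    also have "\<dots> = (\<Sum>j\<in>Q. \<Sum>i\<in>Q. x i * A i j * x j)"
    proof (rule sum.mono_neutral_right[OF I Q(2)], intro ballI)
      fix j assume j: "j \<in> I - Q"
      have "(\<Sum>i\<in>Q. x i * A i j * x j) = x j * (\<Sum>i\<in>Q. A j i * x i)"
        unfolding sum_distrib_left using Q j symD[of j]
        by (intro sum.cong refl) (auto simp: mult_ac)
      also have "(\<Sum>i\<in>Q. A j i * x i) = (\<Sum>i\<in>I. A j i * x i)"
      proof (rule sum.mono_neutral_left[OF I Q(2)], intro ballI)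
        fix i assume "i \<in> I - Q"
        then show "A j i * x i = 0" using propor[OF j, of i] aP[of i] by simp
      qed
      finally show "(\<Sum>i\<in>Q. x i * A i j * x j) = 0" using row0[OF j] by simp
    qed
    also have "\<dots> = bform Q A x x" unfolding bform_def by (rule sum.swap)
    finally have eq: "bform I A x x = bform Q A x x" .
    define D where "D i j = A i j / (a i * a j)" for i j
    \<comment> \<open>Any upper bound on the entries of \<open>D\<close> serves: subtracting from a
      constant reverses the ultrametric inequality, and the constant contributes \<open>C\<close>
      times the square of the sum of \<open>y\<close>, which is zero on the hyperplane.\<close>
    define C where "C = (\<Sum>i\<in>Q. \<Sum>j\<in>Q. D i j)"
    define s where "s i j = C - D i j" for i j
    define y where "y i = a i * x i" for i
    have aQ: "a i > 0" "i \<in> I" if "i \<in> Q" for i using that by (auto simp: Q_def)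
    have D0: "D i j \<ge> 0" if "i \<in> Q" "j \<in> Q" for i j
      using nonneg aQ that by (auto simp: D_def less_imp_le)
    have DC: "D i j \<le> C" if "i \<in> Q" "j \<in> Q" for i j
    proof -
      have "D i j \<le> (\<Sum>j\<in>Q. D i j)" using that D0 Q by (intro member_le_sum) auto
      also have "\<dots> \<le> C" unfolding C_def
        using that D0 Q by (intro member_le_sum[where f = "\<lambda>i. \<Sum>j\<in>Q. D i j"]) (auto intro: sum_nonneg)
      finally show ?thesis .
    qed
    have Dsym: "D i j = D j i" if "i \<in> Q" "j \<in> Q" for i j
      using symD aQ that by (simp add: D_def mult.commute)
    have Dult: "D i j \<le> max (D i l) (D l j)" if ijl: "i \<in> Q" "j \<in> Q" "l \<in> Q" for i j l
    proof -
      have I': "i \<in> I" "j \<in> I" "l \<in> I" and pos: "a i > 0" "a j > 0" "a l > 0" using aQ ijl by auto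
      have "A i j * a l \<le> max (a i * A l j) (A i l * a j)"
        using four[of i j z l] I' zm symD[of i z] symD[of j z] symD[of j l] by (simp add: a_def)
      then have "A i j * a l / (a i * a j * a l) \<le> max (a i * A l j) (A i l * a j) / (a i * a j * a l)"
        using pos by (intro divide_right_mono) auto
      also have "\<dots> = max (a i * A l j / (a i * a j * a l)) (A i l * a j / (a i * a j * a l))"
        using pos by (simp add: max_divide_distrib_right)
      finally show ?thesis using pos by (simp add: D_def field_simps max.commute)
    qed
    have "0 \<le> bform Q s y y"
    proof (rule ultrametric_psd[OF Q(1)])
      show "symm_on Q s" using Dsym by (auto simp: symm_on_def s_def)
      show "0 \<le> s i j" if "i \<in> Q" "j \<in> Q" for i j using DC[OF that] by (simp add: s_def)
      show "min (s i l) (s l j) \<le> s i j" if "i \<in> Q" "j \<in> Q" "l \<in> Q" for i j l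
        using Dult[OF that] by (auto simp: s_def min_def max_def split: if_splits)
    qed
    also have "bform Q s y y = C * (\<Sum>i\<in>Q. y i)\<^sup>2 - bform Q A x x"
    proof -
      have "bform Q s y y = (\<Sum>i\<in>Q. \<Sum>j\<in>Q. C * (y i * y j) - x i * A i j * x j)"
        unfolding bform_def
      proof (intro sum.cong refl)
        fix i j assume "i \<in> Q" "j \<in> Q"
        then have "a i > 0" "a j > 0" using aQ by auto
        then show "y i * s i j * y j = C * (y i * y j) - x i * A i j * x j"
          by (simp add: s_def D_def y_def field_simps)
      qed
      moreover have "C * (\<Sum>i\<in>Q. y i)\<^sup>2 = (\<Sum>i\<in>Q. \<Sum>j\<in>Q. C * (y i * y j))"
        by (simp only: power2_eq_square sum_product) (simp only: sum_distrib_left)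
      ultimately show ?thesis by (simp add: sum_subtractf bform_def)
    qed
    also have "(\<Sum>i\<in>Q. y i) = (\<Sum>i\<in>I. a i * x i)"
      unfolding y_def using I Q aP by (intro sum.mono_neutral_left) auto
    finally show "bform I A x x \<le> 0" using eq x0 by simp
  qed
qed

section \<open>Hessians of exchange functions\<close>

definition inc :: "'i \<Rightarrow> ('i \<Rightarrow> nat) \<Rightarrow> 'i \<Rightarrow> nat" where
  "inc i \<alpha> = \<alpha>(i := Suc (\<alpha> i))"

definition dec :: "'i \<Rightarrow> ('i \<Rightarrow> nat) \<Rightarrow> 'i \<Rightarrow> nat" where
  "dec i \<alpha> = \<alpha>(i := \<alpha> i - 1)"

lemma inc_same [simp]: "inc i \<alpha> i = Suc (\<alpha> i)" by (simp add: inc_def)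
lemma inc_other [simp]: "j \<noteq> i \<Longrightarrow> inc i \<alpha> j = \<alpha> j" by (simp add: inc_def)
lemma dec_same [simp]: "dec i \<alpha> i = \<alpha> i - 1" by (simp add: dec_def)
lemma dec_other [simp]: "j \<noteq> i \<Longrightarrow> dec i \<alpha> j = \<alpha> j" by (simp add: dec_def)

lemma inc_commute: "inc i (inc j \<alpha>) = inc j (inc i \<alpha>)"
  by (auto simp: inc_def fun_eq_iff)

lemma inc_dec: "0 < \<alpha> i \<Longrightarrow> inc i (dec i \<alpha>) = \<alpha>"
  by (auto simp: inc_def dec_def fun_eq_iff)

lemma dec_inc [simp]: "dec i (inc i \<alpha>) = \<alpha>"
  by (auto simp: inc_def dec_def fun_eq_iff)

lemma dec_inc_commute: "i \<noteq> j \<Longrightarrow> dec i (inc j \<alpha>) = inc j (dec i \<alpha>)"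
  by (auto simp: inc_def dec_def fun_eq_iff)

lemma inc_dec_inc: "0 < \<alpha> s \<Longrightarrow> inc t (dec s (inc i \<alpha>)) = inc i (inc t (dec s \<alpha>))"
  by (auto simp: inc_def dec_def fun_eq_iff)

lemma Delta_outside: "\<alpha> \<in> Delta I d \<Longrightarrow> \<alpha> e > 0 \<Longrightarrow> e \<in> I"
  by (auto simp: Delta_def)

lemma inc_in_Delta_iff:
  assumes "finite I" "i \<in> I"
  shows "inc i \<alpha> \<in> Delta I (Suc d) \<longleftrightarrow> \<alpha> \<in> Delta I d"
proof -
  have "(\<Sum>e\<in>I. inc i \<alpha> e) = Suc (\<Sum>e\<in>I. \<alpha> e)"
    using sum.remove[OF assms, of "inc i \<alpha>"] sum.remove[OF assms, of \<alpha>]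
      sum.cong[of "I - {i}" "I - {i}" "inc i \<alpha>" \<alpha>] by simp
  moreover have "(\<forall>e. e \<notin> I \<longrightarrow> inc i \<alpha> e = 0) \<longleftrightarrow> (\<forall>e. e \<notin> I \<longrightarrow> \<alpha> e = 0)"
    using assms by (metis inc_other)
  ultimately show ?thesis by (simp add: Delta_def)
qed

lemma dec_in_Delta:
  assumes "finite I" "\<alpha> \<in> Delta I (Suc d)" "0 < \<alpha> i"
  shows "dec i \<alpha> \<in> Delta I d"
  using inc_in_Delta_iff[OF assms(1) Delta_outside[OF assms(2,3)], of "dec i \<alpha>" d] assms
  by (simp add: inc_dec)

lemma exchange_in_Delta:
  assumes "finite I" "\<alpha> \<in> Delta I d" "0 < \<alpha> s" "t \<in> I"
  shows "inc t (dec s \<alpha>) \<in> Delta I d"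
proof (cases d)
  case 0
  then have "\<alpha> s = 0" using assms Delta_outside[OF assms(2,3)] by (auto simp: Delta_def)
  then show ?thesis using assms by simp
next
  case (Suc d')
  then show ?thesis using dec_in_Delta[of I \<alpha> d' s] assms inc_in_Delta_iff[of I t] by simp
qed

lemma Delta_Suc_decompose:
  assumes "finite I" "\<alpha> \<in> Delta I (Suc d)"
  obtains i \<beta> where "i \<in> I" "\<beta> \<in> Delta I d" "\<alpha> = inc i \<beta>"
proof -
  have "\<exists>i\<in>I. 0 < \<alpha> i"
  proof (rule ccontr)
    assume "\<not> ?thesis"
    then have "(\<Sum>e\<in>I. \<alpha> e) = 0" by simp
    then show False using assms by (simp add: Delta_def)
  qed
  then obtain i where i: "i \<in> I" "0 < \<alpha> i" by auto
  show thesis using that[OF i(1) dec_in_Delta[OF assms i(2)]] inc_dec[of \<alpha> i] i by simp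
qed

lemma finite_Delta:
  assumes "finite I" shows "finite (Delta I d)"
proof (induction d)
  case 0
  have "Delta I 0 \<subseteq> {\<lambda>_. 0}" using assms by (auto simp: Delta_def fun_eq_iff)
  then show ?case using finite_subset by blast
next
  case (Suc d)
  have "Delta I (Suc d) \<subseteq> (\<Union>i\<in>I. inc i ` Delta I d)"
  proof
    fix \<alpha> assume "\<alpha> \<in> Delta I (Suc d)"
    from Delta_Suc_decompose[OF assms this] show "\<alpha> \<in> (\<Union>i\<in>I. inc i ` Delta I d)" by blast
  qed
  moreover have "finite (\<Union>i\<in>I. inc i ` Delta I d)" using Suc assms by auto
  ultimately show ?case by (rule finite_subset)
qed

text \<open>The exponential form \<open>a = q\<^sup>\<nu>\<close> of an M-convex function; the value \<open>\<infinity>\<close> becomes \<open>0\<close>, and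
  the identically vanishing function is allowed so that the notion is stable under \<open>shift\<close>.\<close>
definition exchange_fun :: "'i set \<Rightarrow> nat \<Rightarrow> (('i \<Rightarrow> nat) \<Rightarrow> real) \<Rightarrow> bool" where
  "exchange_fun I d a \<longleftrightarrow>
     (\<forall>\<alpha>\<in>Delta I d. 0 \<le> a \<alpha>) \<and>
     (\<forall>\<alpha>\<in>Delta I d. \<forall>\<beta>\<in>Delta I d. \<forall>s\<in>I. \<beta> s < \<alpha> s \<longrightarrow>
       (\<exists>t\<in>I. \<alpha> t < \<beta> t \<and> a \<alpha> * a \<beta> \<le> a (inc t (dec s \<alpha>)) * a (inc s (dec t \<beta>))))"

lemma exchange_fun_nonneg: "exchange_fun I d a \<Longrightarrow> \<alpha> \<in> Delta I d \<Longrightarrow> 0 \<le> a \<alpha>"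
  by (simp add: exchange_fun_def)

lemma exchange_funE:
  assumes "exchange_fun I d a" "\<alpha> \<in> Delta I d" "\<beta> \<in> Delta I d" "\<beta> s < \<alpha> s"
  obtains t where "t \<in> I" "\<alpha> t < \<beta> t" "a \<alpha> * a \<beta> \<le> a (inc t (dec s \<alpha>)) * a (inc s (dec t \<beta>))"
proof -
  have "s \<in> I" using Delta_outside[OF assms(2), of s] assms(4) by simp
  then show thesis using assms that unfolding exchange_fun_def by blast
qed

definition shift :: "'i \<Rightarrow> (('i \<Rightarrow> nat) \<Rightarrow> real) \<Rightarrow> ('i \<Rightarrow> nat) \<Rightarrow> real" where
  "shift i a = (\<lambda>\<alpha>. a (inc i \<alpha>))"

lemma shift_apply [simp]: "shift i a \<alpha> = a (inc i \<alpha>)" by (simp add: shift_def)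

lemma shift_commute: "shift i (shift j a) = shift j (shift i a)"
  by (simp add: shift_def inc_commute)

lemma exchange_fun_shift:
  assumes I: "finite I" "i \<in> I" and a: "exchange_fun I (Suc d) a"
  shows "exchange_fun I d (shift i a)"
  unfolding exchange_fun_def
proof (intro conjI ballI impI)
  fix \<alpha> assume "\<alpha> \<in> Delta I d"
  then show "0 \<le> shift i a \<alpha>" using a I by (simp add: exchange_fun_nonneg inc_in_Delta_iff)
next
  fix \<alpha> \<beta> s assume h: "\<alpha> \<in> Delta I d" "\<beta> \<in> Delta I d" "s \<in> I" "\<beta> s < \<alpha> s"
  have "inc i \<alpha> \<in> Delta I (Suc d)" "inc i \<beta> \<in> Delta I (Suc d)"
    using h I by (simp_all add: inc_in_Delta_iff)
  moreover have "inc i \<beta> s < inc i \<alpha> s" using h by (auto simp: inc_def)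
  ultimately obtain t where t: "t \<in> I" "inc i \<alpha> t < inc i \<beta> t"
    "a (inc i \<alpha>) * a (inc i \<beta>) \<le> a (inc t (dec s (inc i \<alpha>))) * a (inc s (dec t (inc i \<beta>)))"
    by (rule exchange_funE[OF a])
  have "\<alpha> t < \<beta> t" using t(2) by (simp add: inc_def split: if_splits)
  then have "inc t (dec s (inc i \<alpha>)) = inc i (inc t (dec s \<alpha>))"
    "inc s (dec t (inc i \<beta>)) = inc i (inc s (dec t \<beta>))"
    using h by (auto intro!: inc_dec_inc)
  then show "\<exists>t\<in>I. \<alpha> t < \<beta> t \<and>
      shift i a \<alpha> * shift i a \<beta> \<le> shift i a (inc t (dec s \<alpha>)) * shift i a (inc s (dec t \<beta>))"
    using t \<open>\<alpha> t < \<beta> t\<close> by auto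
qed

text \<open>\<open>genpoly w I d a\<close> is \<open>d!\<close> times the value at \<open>w\<close> of the degree-\<open>d\<close> form with coefficients
  \<open>a \<alpha> / \<alpha>!\<close>: the recursion is Euler's identity, since \<open>\<partial>\<^sub>i\<close> acts on coefficients as \<open>shift i\<close>.\<close>
fun genpoly :: "('i \<Rightarrow> real) \<Rightarrow> 'i set \<Rightarrow> nat \<Rightarrow> (('i \<Rightarrow> nat) \<Rightarrow> real) \<Rightarrow> real" where
  "genpoly w I 0 a = a (\<lambda>_. 0)"
| "genpoly w I (Suc d) a = (\<Sum>i\<in>I. w i * genpoly w I d (shift i a))"

text \<open>Here \<open>d\<close> is the degree of the entries, so the underlying form has degree
  \<open>d + 2\<close>; an entry is \<open>d!\<close> times a second partial derivative at
  \<open>w\<close>.\<close>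

definition hess :: "('i \<Rightarrow> real) \<Rightarrow> 'i set \<Rightarrow> nat \<Rightarrow> (('i \<Rightarrow> nat) \<Rightarrow> real) \<Rightarrow> 'i \<Rightarrow> 'i \<Rightarrow> real" where
  "hess w I d a i j = genpoly w I d (shift j (shift i a))"

section \<open>Positivity and supports of generating polynomials\<close>

lemma genpoly_nonneg:
  assumes "finite I" "\<And>i. i \<in> I \<Longrightarrow> 0 \<le> w i" "\<And>\<alpha>. \<alpha> \<in> Delta I d \<Longrightarrow> 0 \<le> a \<alpha>"
  shows "0 \<le> genpoly w I d a"
  using assms(3)
proof (induction d arbitrary: a)
  case (Suc d)
  show ?case unfolding genpoly.simps
    using assms(1,2) Suc by (intro sum_nonneg mult_nonneg_nonneg) (auto simp: inc_in_Delta_iff)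
qed (simp add: Delta_def)

lemma genpoly_pos_iff:
  assumes "finite I" "\<And>i. i \<in> I \<Longrightarrow> 0 < w i" "\<And>\<alpha>. \<alpha> \<in> Delta I d \<Longrightarrow> 0 \<le> a \<alpha>"
  shows "0 < genpoly w I d a \<longleftrightarrow> (\<exists>\<alpha>\<in>Delta I d. 0 < a \<alpha>)"
  using assms(3)
proof (induction d arbitrary: a)
  case 0
  have "Delta I 0 = {\<lambda>_. 0}" using assms(1) by (auto simp: Delta_def fun_eq_iff)
  then show ?case by simp
next
  case (Suc d)
  have nn: "0 \<le> shift i a \<alpha>" if "i \<in> I" "\<alpha> \<in> Delta I d" for i \<alpha>
    using Suc.prems that assms(1) by (simp add: inc_in_Delta_iff)
  have gn: "0 \<le> w i * genpoly w I d (shift i a)" if "i \<in> I" for i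
    using assms(1,2) nn that by (intro mult_nonneg_nonneg genpoly_nonneg) (auto simp: less_imp_le)
  have "0 < genpoly w I (Suc d) a \<longleftrightarrow> (\<exists>i\<in>I. 0 < w i * genpoly w I d (shift i a))"
  proof
    assume "0 < genpoly w I (Suc d) a"
    then show "\<exists>i\<in>I. 0 < w i * genpoly w I d (shift i a)"
      using sum_nonpos[of I "\<lambda>i. w i * genpoly w I d (shift i a)"] by fastforce
  next
    assume "\<exists>i\<in>I. 0 < w i * genpoly w I d (shift i a)"
    then show "0 < genpoly w I (Suc d) a"
      using sum_pos2[of I _ "\<lambda>i. w i * genpoly w I d (shift i a)"] assms(1) gn by auto
  qed
  also have "\<dots> \<longleftrightarrow> (\<exists>i\<in>I. \<exists>\<alpha>\<in>Delta I d. 0 < a (inc i \<alpha>))"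
  proof (intro bex_cong refl)
    fix i assume i: "i \<in> I"
    have "0 < w i * genpoly w I d (shift i a) \<longleftrightarrow> 0 < genpoly w I d (shift i a)"
      using assms(2)[OF i] by (simp add: zero_less_mult_iff)
    then show "0 < w i * genpoly w I d (shift i a) \<longleftrightarrow> (\<exists>\<alpha>\<in>Delta I d. 0 < a (inc i \<alpha>))"
      using Suc.IH[OF nn[OF i]] by simp
  qed
  also have "\<dots> \<longleftrightarrow> (\<exists>\<alpha>\<in>Delta I (Suc d). 0 < a \<alpha>)"
  proof
    assume "\<exists>i\<in>I. \<exists>\<alpha>\<in>Delta I d. 0 < a (inc i \<alpha>)"
    then show "\<exists>\<alpha>\<in>Delta I (Suc d). 0 < a \<alpha>" using inc_in_Delta_iff[OF assms(1)] by blast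
  next
    assume "\<exists>\<alpha>\<in>Delta I (Suc d). 0 < a \<alpha>"
    then obtain \<alpha> where al: "\<alpha> \<in> Delta I (Suc d)" "0 < a \<alpha>" by blast
    from Delta_Suc_decompose[OF assms(1) al(1)] show "\<exists>i\<in>I. \<exists>\<alpha>\<in>Delta I d. 0 < a (inc i \<alpha>)"
      using al(2) by blast
  qed
  finally show ?case .
qed

lemma hess_symm: "symm_on I (hess w I d a)"
  by (simp add: symm_on_def hess_def shift_commute)

lemma hess_row: "(\<Sum>j\<in>I. hess w I d a i j * w j) = genpoly w I (Suc d) (shift i a)"
  by (simp add: hess_def mult.commute)

text \<open>Euler's identity applied to the second derivatives; it links consecutive degrees in the
  induction.\<close>

lemma hess_Suc: "hess w I (Suc d) a j k = (\<Sum>i\<in>I. w i * hess w I d (shift i a) j k)"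
proof -
  have "shift i (shift k (shift j a)) = shift k (shift j (shift i a))" for i
    by (simp add: shift_commute)
  then show ?thesis by (simp add: hess_def)
qed

lemma hess_pos:
  assumes I: "finite I" and w: "\<And>i. i \<in> I \<Longrightarrow> 0 < w i" and ij: "i \<in> I" "j \<in> I"
    and a: "\<And>\<alpha>. \<alpha> \<in> Delta I (Suc (Suc d)) \<Longrightarrow> 0 \<le> a \<alpha>"
    and pos: "\<gamma> \<in> Delta I d" "0 < a (inc i (inc j \<gamma>))"
  shows "0 < hess w I d a i j"
proof -
  have "0 \<le> shift j (shift i a) \<alpha>" if "\<alpha> \<in> Delta I d" for \<alpha>
    using a that I ij by (simp add: inc_in_Delta_iff)
  then have "0 < genpoly w I d (shift j (shift i a)) \<longleftrightarrow> (\<exists>\<alpha>\<in>Delta I d. 0 < shift j (shift i a) \<alpha>)"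
    using I w by (intro genpoly_pos_iff) auto
  then show ?thesis using pos by (auto simp: hess_def)
qed

text \<open>Take support elements \<open>e_i + \<alpha>\<close> and \<open>e_j + \<beta>\<close>
  with \<open>i \<noteq> j\<close>. If \<open>\<alpha>\<close> lacks \<open>j\<close>, exchanging at
  \<open>j\<close> puts some \<open>e_i + \<alpha> - e_t + e_j\<close> in the support. For
  \<open>t \<noteq> i\<close> it contains both \<open>i\<close> and \<open>j\<close>; for
  \<open>t = i\<close> any \<open>k\<close> occurring in \<open>\<alpha>\<close> is joined to
  both.\<close>

lemma hess_connected:
  assumes I: "finite I" and w: "\<And>i. i \<in> I \<Longrightarrow> 0 < w i" and a: "exchange_fun I (Suc (Suc d)) a"
    and ij: "i \<in> I" "j \<in> I"
    and pos: "0 < genpoly w I (Suc d) (shift i a)" "0 < genpoly w I (Suc d) (shift j a)"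
  shows "0 < hess w I d a i j \<or> (\<exists>k\<in>I. 0 < hess w I d a i k \<and> 0 < hess w I d a k j)"
proof -
  have nn: "\<And>\<alpha>. \<alpha> \<in> Delta I (Suc (Suc d)) \<Longrightarrow> 0 \<le> a \<alpha>" by (rule exchange_fun_nonneg[OF a])
  have hpos: "0 < hess w I d a i j" if "i \<in> I" "j \<in> I" "\<gamma> \<in> Delta I d" "0 < a (inc i (inc j \<gamma>))" for i j \<gamma>
    by (rule hess_pos[where \<gamma> = \<gamma>]) (use I w nn that in auto)
  have shn: "\<And>\<alpha>. \<alpha> \<in> Delta I (Suc d) \<Longrightarrow> 0 \<le> shift k a \<alpha>" if "k \<in> I" for k
    using nn I that by (simp add: inc_in_Delta_iff)
  have iff: "0 < genpoly w I (Suc d) (shift k a) \<longleftrightarrow> (\<exists>\<alpha>\<in>Delta I (Suc d). 0 < shift k a \<alpha>)"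
    if "k \<in> I" for k
    by (rule genpoly_pos_iff[OF I w shn[OF that]])
  obtain \<alpha> where al: "\<alpha> \<in> Delta I (Suc d)" "0 < a (inc i \<alpha>)" using pos iff[OF ij(1)] by auto
  obtain \<beta> where be: "\<beta> \<in> Delta I (Suc d)" "0 < a (inc j \<beta>)" using pos iff[OF ij(2)] by auto
  obtain k \<gamma> where k: "k \<in> I" "\<gamma> \<in> Delta I d" "\<alpha> = inc k \<gamma>" using Delta_Suc_decompose[OF I al(1)] .
  have ik: "0 < hess w I d a i k" using hpos[OF ij(1) k(1,2)] al k by simp
  have sym: "hess w I d a p q = hess w I d a q p" for p q by (simp add: hess_def shift_commute)
  show ?thesis
  proof (cases "i = j")
    case True
    then show ?thesis using ik k sym by metis
  next
    case ne: False
    show ?thesis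
    proof (cases "0 < \<alpha> j")
      case True
      have "dec j \<alpha> \<in> Delta I d" using dec_in_Delta[OF I al(1) True] .
      then show ?thesis using hpos[OF ij, of "dec j \<alpha>"] al inc_dec[of \<alpha> j] True by simp
    next
      case False
      have A: "inc i \<alpha> \<in> Delta I (Suc (Suc d))" and B: "inc j \<beta> \<in> Delta I (Suc (Suc d))"
        using al be I ij by (simp_all add: inc_in_Delta_iff)
      have "inc i \<alpha> j < inc j \<beta> j" using False ne by simp
      from exchange_funE[OF a B A this] obtain t where t: "t \<in> I" "inc j \<beta> t < inc i \<alpha> t"
        "a (inc j \<beta>) * a (inc i \<alpha>) \<le> a (inc t (dec j (inc j \<beta>))) * a (inc j (dec t (inc i \<alpha>)))" .
      have "inc t (dec j (inc j \<beta>)) \<in> Delta I (Suc (Suc d))"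
        using be t I by (simp add: inc_in_Delta_iff)
      then have "0 \<le> a (inc t (dec j (inc j \<beta>)))" by (rule nn)
      moreover have "0 < a (inc j \<beta>) * a (inc i \<alpha>)" using al be by simp
      ultimately have C: "0 < a (inc j (dec t (inc i \<alpha>)))"
        using t(3) by (smt (verit) mult_nonneg_nonpos)
      show ?thesis
      proof (cases "t = i")
        case True
        then have "0 < a (inc k (inc j \<gamma>))" using C k by (simp add: inc_commute)
        then show ?thesis using hpos[OF k(1) ij(2) k(2)] ik k by auto
      next
        case False
        then have "0 < \<alpha> t" using t(2) by simp
        then have "dec t \<alpha> \<in> Delta I d" using dec_in_Delta[OF I al(1)] by simp
        moreover have "inc j (dec t (inc i \<alpha>)) = inc i (inc j (dec t \<alpha>))"
          using False by (simp add: dec_inc_commute inc_commute)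
        ultimately show ?thesis using hpos[OF ij, of "dec t \<alpha>"] C by simp
      qed
    qed
  qed
qed

text \<open>In degree two, a unit removed from \<open>e_i + e_j\<close> at \<open>i\<close> can only
  be replaced by \<open>k\<close> or \<open>l\<close>, and the two outcomes are the two products in
  the maximum. If \<open>i\<close> is \<open>k\<close> or \<open>l\<close>, the left side is already
  one of them.\<close>

lemma exchange_fun_four_point:
  assumes I: "finite I" and a: "exchange_fun I 2 a"
    and el: "i \<in> I" "j \<in> I" "k \<in> I" "l \<in> I"
  defines "A \<equiv> \<lambda>i j. a (inc i (inc j (\<lambda>_. 0)))"
  shows "A i j * A k l \<le> max (A i k * A j l) (A i l * A j k)"
proof -
  have z: "(\<lambda>_. 0) \<in> Delta I 0" by (simp add: Delta_def)
  have D: "inc i (inc j (\<lambda>_. 0)) \<in> Delta I 2" if "i \<in> I" "j \<in> I" for i j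
    using z I that by (simp add: numeral_2_eq_2 inc_in_Delta_iff)
  have sym: "A i j = A j i" for i j by (simp add: A_def inc_commute)
  show ?thesis
  proof (cases "i = k \<or> i = l")
    case True
    then show ?thesis using sym by (auto simp: mult.commute)
  next
    case False
    then have "inc k (inc l (\<lambda>_. 0)) i < inc i (inc j (\<lambda>_. 0)) i" by (simp add: inc_def)
    from exchange_funE[OF a D[OF el(1,2)] D[OF el(3,4)] this] obtain t where t: "t \<in> I"
      "inc i (inc j (\<lambda>_. 0)) t < inc k (inc l (\<lambda>_. 0)) t"
      "A i j * A k l \<le> a (inc t (dec i (inc i (inc j (\<lambda>_. 0))))) * a (inc i (dec t (inc k (inc l (\<lambda>_. 0)))))"
      unfolding A_def .
    from t(2) have "t = k \<or> t = l" by (auto simp: inc_def split: if_splits)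
    then show ?thesis
    proof
      assume "t = k"
      then have "A i j * A k l \<le> A k j * A i l" using t(3) by (simp add: A_def)
      then show ?thesis using sym[of k j] by (simp add: mult.commute)
    next
      assume tl: "t = l"
      have "inc k (inc l (\<lambda>_. 0)) = inc l (inc k (\<lambda>_. 0))" by (rule inc_commute)
      then have "A i j * A k l \<le> A l j * A i k" using t(3) tl by (simp add: A_def)
      then show ?thesis using sym[of l j] by (simp add: mult.commute)
    qed
  qed
qed

theorem hess_lorentzian:
  assumes I: "finite I" and w: "\<And>i. i \<in> I \<Longrightarrow> 0 < w i" and a: "exchange_fun I (Suc (Suc d)) a"
  shows "lorentzian_form I (hess w I d a)"
  using a
proof (induction d arbitrary: a)
  case 0
  have e2: "exchange_fun I 2 a" using 0 by (simp add: numeral_2_eq_2)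
  have z: "(\<lambda>_. 0) \<in> Delta I 0" by (simp add: Delta_def)
  have h: "hess w I 0 a = (\<lambda>i j. a (inc i (inc j (\<lambda>_. 0))))" by (simp add: hess_def fun_eq_iff)
  show ?case
  proof (rule lorentzian_form_four_point[OF I hess_symm])
    show "0 \<le> hess w I 0 a i j" if "i \<in> I" "j \<in> I" for i j
      unfolding h using that I z exchange_fun_nonneg[OF 0] by (simp add: inc_in_Delta_iff)
    show "hess w I 0 a i j * hess w I 0 a k l \<le>
        max (hess w I 0 a i k * hess w I 0 a j l) (hess w I 0 a i l * hess w I 0 a j k)"
      if "i \<in> I" "j \<in> I" "k \<in> I" "l \<in> I" for i j k l
      unfolding h using exchange_fun_four_point[OF I e2 that] .
  qed
next
  case (Suc d)
  define p where "p i = genpoly w I (Suc (Suc d)) (shift i a)" for i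
  have w0: "\<And>i. i \<in> I \<Longrightarrow> 0 \<le> w i" using w by (simp add: less_imp_le)
  have nn: "\<And>\<alpha>. \<alpha> \<in> Delta I (Suc (Suc (Suc d))) \<Longrightarrow> 0 \<le> a \<alpha>" by (rule exchange_fun_nonneg[OF Suc.prems])
  have hn: "0 \<le> hess w I (Suc d) a i j" if "i \<in> I" "j \<in> I" for i j
    unfolding hess_def using nn I that by (intro genpoly_nonneg w0) (auto simp: inc_in_Delta_iff)
  have hn': "0 \<le> hess w I d (shift k a) i j" if "i \<in> I" "j \<in> I" "k \<in> I" for i j k
    unfolding hess_def using nn I that by (intro genpoly_nonneg w0) (auto simp: inc_in_Delta_iff)
  have p: "p i = (\<Sum>j\<in>I. hess w I (Suc d) a i j * w j)" for i
    unfolding p_def hess_row ..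
  \<comment> \<open>Symmetry of third derivatives: the Hessian of the \<open>i\<close>-th partial
    derivative maps \<open>w\<close> to row \<open>i\<close> of the full Hessian. Hence reverse
    Cauchy-Schwarz at \<open>w\<close> and \<open>v\<close>, from the induction hypothesis, yields
    the summand for \<open>i\<close> in the required bound.\<close>
  have row: "(\<Sum>k\<in>I. hess w I d (shift i a) j k * w k) = hess w I (Suc d) a i j" for i j
    unfolding hess_row by (simp add: hess_def shift_commute)
  show ?case
  proof (rule lorentzian_form_trickle_down[OF I hess_symm hn w p])
    show "0 < hess w I (Suc d) a i j \<or> (\<exists>k\<in>I. 0 < hess w I (Suc d) a i k \<and> 0 < hess w I (Suc d) a k j)"
      if "i \<in> I" "j \<in> I" "0 < p i" "0 < p j" for i j
      using hess_connected[OF I w Suc.prems that(1,2)] that(3,4) by (simp add: p_def)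
  next
    fix v
    have "bform I (hess w I (Suc d) a) v v = (\<Sum>i\<in>I. w i * bform I (hess w I d (shift i a)) v v)"
    proof -
      have "bform I (hess w I (Suc d) a) v v =
          (\<Sum>j\<in>I. \<Sum>k\<in>I. \<Sum>i\<in>I. w i * (v j * hess w I d (shift i a) j k * v k))"
        unfolding bform_def hess_Suc by (simp add: sum_distrib_left sum_distrib_right mult_ac)
      also have "\<dots> = (\<Sum>j\<in>I. \<Sum>i\<in>I. \<Sum>k\<in>I. w i * (v j * hess w I d (shift i a) j k * v k))"
        by (intro sum.cong refl sum.swap)
      also have "\<dots> = (\<Sum>i\<in>I. \<Sum>j\<in>I. \<Sum>k\<in>I. w i * (v j * hess w I d (shift i a) j k * v k))"
        by (rule sum.swap)
      finally show ?thesis by (simp add: bform_def sum_distrib_left)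
    qed
    also have "\<dots> \<le> (\<Sum>i\<in>I. w i * (\<Sum>j\<in>I. hess w I (Suc d) a i j * v j)\<^sup>2 / p i)"
    proof (rule sum_mono)
      fix i assume i: "i \<in> I"
      let ?B = "hess w I d (shift i a)" and ?s = "\<Sum>j\<in>I. hess w I (Suc d) a i j * v j"
      have Bvw: "bform I ?B w v = ?s"
      proof -
        have "bform I ?B w v = bform I ?B v w" by (rule bform_commute[OF hess_symm])
        then show ?thesis by (simp only: bform_row row) (simp add: mult.commute)
      qed
      have Bww: "bform I ?B w w = p i"
        unfolding bform_row row by (simp add: p mult.commute)
      have p0: "0 \<le> p i" unfolding p using i hn w0 by (intro sum_nonneg mult_nonneg_nonneg)
      have "bform I ?B v v \<le> ?s\<^sup>2 / p i"
      proof (cases "p i = 0")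
        \<comment> \<open>The right-hand side is \<open>0\<close> by division by zero, so the left
          must vanish: nonnegative entries with zero weighted sums are zero, first in row
          \<open>i\<close> of the full Hessian, then in \<open>?B\<close>.\<close>
        case True
        have "hess w I (Suc d) a i j = 0" if j: "j \<in> I" for j
        proof -
          have "\<forall>j\<in>I. hess w I (Suc d) a i j * w j = 0"
            using True i hn w0 unfolding p
            by (subst (asm) sum_nonneg_eq_0_iff[OF I]) auto
          then show ?thesis using w j by force
        qed
        then have z: "(\<Sum>k\<in>I. ?B j k * w k) = 0" if "j \<in> I" for j using row that by simp
        have "?B j k = 0" if jk: "j \<in> I" "k \<in> I" for j k
        proof -
          have "\<forall>k\<in>I. ?B j k * w k = 0"
            using z[OF jk(1)] i hn' w0 jk
            by (subst (asm) sum_nonneg_eq_0_iff[OF I]) auto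
          then show ?thesis using w jk by force
        qed
        then have "bform I ?B v v = 0" by (simp add: bform_def)
        then show ?thesis using True by simp
      next
        case False
        then have "0 < p i" using p0 by simp
        moreover have "lorentzian_form I ?B"
          using Suc.IH exchange_fun_shift[OF I i Suc.prems] by blast
        ultimately have "p i * bform I ?B v v \<le> ?s\<^sup>2"
          unfolding lorentzian_form_def using Bvw Bww by metis
        then show ?thesis using \<open>0 < p i\<close> by (simp add: field_simps)
      qed
      then show "w i * bform I ?B v v \<le> w i * ?s\<^sup>2 / p i"
        using mult_left_mono[OF _ w0[OF i]] by fastforce
    qed
    finally show "bform I (hess w I (Suc d) a) v v \<le>
        (\<Sum>i\<in>I. w i * (\<Sum>j\<in>I. hess w I (Suc d) a i j * v j)\<^sup>2 / p i)" .
  qed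
qed

text \<open>Reverse Cauchy-Schwarz for the Hessian form at \<open>w\<close> and \<open>e_z\<close>;
  if the value at \<open>(w, w)\<close> is zero, so is the left side.\<close>

lemma genpoly_log_concave:
  assumes I: "finite I" "z \<in> I" and w: "\<And>i. i \<in> I \<Longrightarrow> 0 < w i"
    and a: "exchange_fun I (Suc (Suc d)) a"
  shows "genpoly w I d (shift z (shift z a)) * genpoly w I (Suc (Suc d)) a
    \<le> (genpoly w I (Suc d) (shift z a))\<^sup>2"
proof -
  let ?H = "hess w I d a"
  define v where "v i = (if i = z then 1 else 0 :: real)" for i
  have ww: "bform I ?H w w = genpoly w I (Suc (Suc d)) a"
    unfolding bform_row hess_row by simp
  have pick: "(\<Sum>i\<in>I. v i * f i) = f z" for f
  proof -
    have "(\<Sum>i\<in>I. v i * f i) = (\<Sum>i\<in>I. if i = z then f z else 0)"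
      by (intro sum.cong) (auto simp: v_def)
    then show ?thesis using I by simp
  qed
  have vw: "bform I ?H v w = genpoly w I (Suc d) (shift z a)"
    unfolding bform_row hess_row pick ..
  have vv: "bform I ?H v v = genpoly w I d (shift z (shift z a))"
  proof -
    have "bform I ?H v v = ?H z z"
      unfolding bform_row pick using pick[of "?H z"] by (simp add: mult.commute)
    then show ?thesis by (simp add: hess_def)
  qed
  have "0 \<le> genpoly w I (Suc (Suc d)) a"
    using I w exchange_fun_nonneg[OF a] by (intro genpoly_nonneg) (auto simp: less_imp_le)
  then consider "genpoly w I (Suc (Suc d)) a = 0" | "0 < bform I ?H w w" using ww by linarith
  then show ?thesis
  proof cases
    case 2
    then have "bform I ?H w w * bform I ?H v v \<le> (bform I ?H w v)\<^sup>2"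
      using hess_lorentzian[OF I(1) w a] by (simp add: lorentzian_form_def)
    also have "bform I ?H w v = bform I ?H v w" by (rule bform_commute[OF hess_symm])
    finally show ?thesis unfolding ww vw vv by (simp add: mult.commute)
  qed (simp del: genpoly.simps)
qed

section \<open>Passage to points with vanishing coordinates\<close>

lemma tendsto_genpoly:
  assumes "\<And>i. i \<in> I \<Longrightarrow> ((\<lambda>x. w x i) \<longlongrightarrow> w0 i) F"
  shows "((\<lambda>x. genpoly (w x) I d a) \<longlongrightarrow> genpoly w0 I d a) F"
proof (induction d arbitrary: a)
  case (Suc d)
  show ?case unfolding genpoly.simps by (intro tendsto_sum tendsto_mult assms Suc)
qed simp

lemma genpoly_log_concave_boundary:
  assumes I: "finite I" "z \<in> I" and w: "\<And>i. i \<in> I \<Longrightarrow> 0 \<le> w i"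
    and a: "exchange_fun I (Suc (Suc d)) a"
  shows "genpoly w I d (shift z (shift z a)) * genpoly w I (Suc (Suc d)) a
    \<le> (genpoly w I (Suc d) (shift z a))\<^sup>2"
proof (rule tendsto_le)
  let ?w = "\<lambda>x i. w i + x"
  have lim: "((\<lambda>x. genpoly (?w x) I n b) \<longlongrightarrow> genpoly w I n b) (at_right 0)" for n b
  proof (rule tendsto_genpoly)
    fix i
    have "((\<lambda>x. w i + x) \<longlongrightarrow> w i + 0) (at_right 0)" by (intro tendsto_intros)
    then show "((\<lambda>x. w i + x) \<longlongrightarrow> w i) (at_right 0)" by simp
  qed
  show "((\<lambda>x. genpoly (?w x) I d (shift z (shift z a)) * genpoly (?w x) I (Suc (Suc d)) a) \<longlongrightarrow>
      genpoly w I d (shift z (shift z a)) * genpoly w I (Suc (Suc d)) a) (at_right 0)"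
    by (intro tendsto_mult lim)
  show "((\<lambda>x. (genpoly (?w x) I (Suc d) (shift z a))\<^sup>2) \<longlongrightarrow> (genpoly w I (Suc d) (shift z a))\<^sup>2) (at_right 0)"
    by (intro tendsto_power lim)
  show "eventually (\<lambda>x. genpoly (?w x) I d (shift z (shift z a)) * genpoly (?w x) I (Suc (Suc d)) a
      \<le> (genpoly (?w x) I (Suc d) (shift z a))\<^sup>2) (at_right 0)"
    unfolding eventually_at_right_field
  proof (intro exI[of _ 1] conjI allI impI)
    fix x :: real assume "0 < x" "x < 1"
    then show "genpoly (?w x) I d (shift z (shift z a)) * genpoly (?w x) I (Suc (Suc d)) a
      \<le> (genpoly (?w x) I (Suc d) (shift z a))\<^sup>2"
      using w by (intro genpoly_log_concave[OF I _ a]) (simp add: add_nonneg_pos)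
  qed simp
qed simp

section \<open>Homogenization\<close>

definition padd :: "('e \<Rightarrow> nat) \<Rightarrow> ('e \<Rightarrow> nat) \<Rightarrow> 'e \<Rightarrow> nat" where
  "padd \<alpha> \<gamma> = (\<lambda>e. \<alpha> e + \<gamma> e)"

text \<open>Truncated subtraction makes this the total amount by which \<open>\<gamma>\<close>
  exceeds \<open>\<delta>\<close>; it is the potential that selects completions close to each
  other.\<close>

definition excess :: "'e set \<Rightarrow> ('e \<Rightarrow> nat) \<Rightarrow> ('e \<Rightarrow> nat) \<Rightarrow> nat" where
  "excess E \<gamma> \<delta> = (\<Sum>e\<in>E. \<gamma> e - \<delta> e)"

text \<open>The best value among completions of \<open>\<alpha>\<close> by \<open>n\<close> further
  units; \<open>n\<close> is a separate argument because it becomes the coordinate at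
  \<open>None\<close>.\<close>

definition top_value :: "'e set \<Rightarrow> (('e \<Rightarrow> nat) \<Rightarrow> real) \<Rightarrow> ('e \<Rightarrow> nat) \<Rightarrow> nat \<Rightarrow> real" where
  "top_value E a \<alpha> n = Max ((\<lambda>\<gamma>. a (padd \<alpha> \<gamma>)) ` Delta E n)"

lemma padd_commute: "padd \<alpha> \<gamma> = padd \<gamma> \<alpha>"
  by (simp add: padd_def add.commute)

lemma padd_in_Delta: "\<alpha> \<in> Delta E k \<Longrightarrow> \<gamma> \<in> Delta E n \<Longrightarrow> padd \<alpha> \<gamma> \<in> Delta E (k + n)"
  by (auto simp: Delta_def padd_def sum.distrib)

lemma Delta_nonempty:
  assumes "finite E" "E \<noteq> {}"
  shows "Delta E n \<noteq> {}"
proof (induction n)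
  case 0
  have "(\<lambda>_. 0) \<in> Delta E 0" by (simp add: Delta_def)
  then show ?case by blast
next
  case (Suc n)
  then obtain \<alpha> e where "\<alpha> \<in> Delta E n" "e \<in> E" using assms by blast
  then have "inc e \<alpha> \<in> Delta E (Suc n)" using assms by (simp add: inc_in_Delta_iff)
  then show ?case by blast
qed

lemma Delta_less_ex:
  assumes "\<alpha> \<in> Delta E k" "\<beta> \<in> Delta E l" "k < l"
  shows "\<exists>t\<in>E. \<alpha> t < \<beta> t"
proof (rule ccontr)
  assume "\<not> ?thesis"
  then have "(\<Sum>e\<in>E. \<beta> e) \<le> (\<Sum>e\<in>E. \<alpha> e)" by (intro sum_mono) force
  then show False using assms by (simp add: Delta_def)
qed

lemma Delta_le_ex:
  assumes "finite E" "\<alpha> \<in> Delta E k" "\<beta> \<in> Delta E l" "k \<le> l" "\<beta> s < \<alpha> s"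
  shows "\<exists>t\<in>E. \<alpha> t < \<beta> t"
proof (rule ccontr)
  assume "\<not> ?thesis"
  then have "(\<Sum>e\<in>E. \<beta> e) < (\<Sum>e\<in>E. \<alpha> e)"
    using assms Delta_outside[OF assms(2), of s] by (intro sum_strict_mono_ex1) force+
  then show False using assms by (simp add: Delta_def)
qed

lemma excess_exchange:
  assumes "finite E" "s \<in> E" "\<delta> s < \<gamma> s" "\<gamma> t < \<delta> t"
  shows "excess E (inc t (dec s \<gamma>)) \<delta> < excess E \<gamma> \<delta>"
  unfolding excess_def
proof (rule sum_strict_mono_ex1[OF assms(1)])
  show "\<forall>e\<in>E. inc t (dec s \<gamma>) e - \<delta> e \<le> \<gamma> e - \<delta> e"
    using assms by (auto simp: inc_def dec_def)
  show "\<exists>e\<in>E. inc t (dec s \<gamma>) e - \<delta> e < \<gamma> e - \<delta> e"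
    using assms by (intro bexI[of _ s]) (auto simp: inc_def dec_def)
qed

text \<open>Shows that both members of a pair are optimal once their product reaches the positive
  product of the optima.\<close>

lemma product_maximal:
  fixes x y :: real
  assumes "0 \<le> x" "x \<le> X" "0 \<le> y" "y \<le> Y" "X * Y \<le> x * y" "0 < X * Y"
  shows "x = X \<and> y = Y"
proof -
  have X: "0 < X" "0 < Y" using assms by (auto simp: zero_less_mult_iff)
  have "x * y \<le> x * Y" "x * Y \<le> X * Y" "x * y \<le> X * y" "X * y \<le> X * Y"
    using assms X by (auto intro: mult_left_mono mult_right_mono)
  then have eq: "x * Y = X * Y" "X * y = X * Y" using assms by linarith+
  show ?thesis
  proof
    show "x = X" using eq(1) X by simp
    show "y = Y" using eq(2) X by simp
  qed
qed

definition homogenization :: "'e set \<Rightarrow> (('e \<Rightarrow> nat) \<Rightarrow> real) \<Rightarrow> ('e option \<Rightarrow> nat) \<Rightarrow> real" where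
  "homogenization E a h = top_value E a (h \<circ> Some) (h None)"

context
  fixes E :: "'e set" and r :: nat and a :: "('e \<Rightarrow> nat) \<Rightarrow> real"
  assumes E: "finite E" "E \<noteq> {}" and a: "exchange_fun E r a"
begin

lemma top_value_ge: "\<gamma> \<in> Delta E n \<Longrightarrow> a (padd \<alpha> \<gamma>) \<le> top_value E a \<alpha> n"
  unfolding top_value_def using finite_Delta[OF E(1)] by (intro Max_ge) auto

lemma top_value_attained:
  obtains \<gamma> where "\<gamma> \<in> Delta E n" "a (padd \<alpha> \<gamma>) = top_value E a \<alpha> n"
proof -
  have "top_value E a \<alpha> n \<in> (\<lambda>\<gamma>. a (padd \<alpha> \<gamma>)) ` Delta E n"
    unfolding top_value_def using finite_Delta[OF E(1)] Delta_nonempty[OF E] by (intro Max_in) auto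
  then show thesis using that by auto
qed

lemma padd_nonneg: "\<alpha> \<in> Delta E k \<Longrightarrow> \<gamma> \<in> Delta E n \<Longrightarrow> k + n = r \<Longrightarrow> 0 \<le> a (padd \<alpha> \<gamma>)"
  using exchange_fun_nonneg[OF a] padd_in_Delta by blast

lemma top_value_nonneg:
  assumes "\<alpha> \<in> Delta E k" "k + n = r"
  shows "0 \<le> top_value E a \<alpha> n"
  using top_value_attained[of n \<alpha>] padd_nonneg assms by metis

lemma product_le_top:
  assumes "\<alpha> \<in> Delta E k" "k + n = r" "\<gamma> \<in> Delta E n" "\<beta> \<in> Delta E l" "l + m = r" "\<delta> \<in> Delta E m"
  shows "a (padd \<alpha> \<gamma>) * a (padd \<beta> \<delta>) \<le> top_value E a \<alpha> n * top_value E a \<beta> m"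
  using assms top_value_ge padd_nonneg top_value_nonneg by (intro mult_mono) auto

text \<open>The coordinate \<open>t\<close> returned by an exchange of the sums has
  \<open>\<alpha> t < \<beta> t\<close> or \<open>\<gamma> t < \<delta> t\<close>; the unit is
  charged to a layer where this holds, so no subtraction truncates.\<close>

lemma split_exchange:
  assumes D: "padd \<alpha> \<gamma> \<in> Delta E r" "padd \<beta> \<delta> \<in> Delta E r" and s: "\<beta> s < \<alpha> s"
  obtains
    (same) t where "t \<in> E" "\<alpha> t < \<beta> t"
      "a (padd \<alpha> \<gamma>) * a (padd \<beta> \<delta>) \<le> a (padd (inc t (dec s \<alpha>)) \<gamma>) * a (padd (inc s (dec t \<beta>)) \<delta>)"
  | (other) t where "t \<in> E" "\<gamma> t < \<delta> t"
      "a (padd \<alpha> \<gamma>) * a (padd \<beta> \<delta>) \<le> a (padd (dec s \<alpha>) (inc t \<gamma>)) * a (padd (inc s \<beta>) (dec t \<delta>))"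
proof (cases "padd \<beta> \<delta> s < padd \<alpha> \<gamma> s")
  case True
  from exchange_funE[OF a D this] obtain t where t: "t \<in> E" "padd \<alpha> \<gamma> t < padd \<beta> \<delta> t"
    "a (padd \<alpha> \<gamma>) * a (padd \<beta> \<delta>) \<le> a (inc t (dec s (padd \<alpha> \<gamma>))) * a (inc s (dec t (padd \<beta> \<delta>)))" .
  from t(2) consider "\<alpha> t < \<beta> t" | "\<gamma> t < \<delta> t" by (fastforce simp: padd_def)
  then show thesis
  proof cases
    case 1
    have "inc t (dec s (padd \<alpha> \<gamma>)) = padd (inc t (dec s \<alpha>)) \<gamma>" "inc s (dec t (padd \<beta> \<delta>)) = padd (inc s (dec t \<beta>)) \<delta>"
      using s 1 by (auto simp: fun_eq_iff padd_def inc_def dec_def)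
    then show thesis using same[OF t(1) 1] t(3) by simp
  next
    case 2
    have "inc t (dec s (padd \<alpha> \<gamma>)) = padd (dec s \<alpha>) (inc t \<gamma>)" "inc s (dec t (padd \<beta> \<delta>)) = padd (inc s \<beta>) (dec t \<delta>)"
      using s 2 by (auto simp: fun_eq_iff padd_def inc_def dec_def)
    then show thesis using other[OF t(1) 2] t(3) by simp
  qed
next
  case False
  \<comment> \<open>The surplus of \<open>\<alpha>\<close> at \<open>s\<close> is offset in the
    completions. Moving the unit between the layers leaves both sums unchanged, so
    \<open>t = s\<close> works with equality.\<close>
  then have "\<gamma> s < \<delta> s" using s by (simp add: padd_def)
  moreover have "padd (dec s \<alpha>) (inc s \<gamma>) = padd \<alpha> \<gamma>" "padd (inc s \<beta>) (dec s \<delta>) = padd \<beta> \<delta>"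
    using s \<open>\<gamma> s < \<delta> s\<close> by (auto simp: fun_eq_iff padd_def inc_def dec_def)
  moreover have "s \<in> E"
    using Delta_outside[OF D(1), of s] s by (simp add: padd_def)
  ultimately show thesis using other[of s] by simp
qed

text \<open>Minimality of \<open>\<gamma>\<close> against a fixed \<open>\<delta>\<close> suffices:
  an exchange inside the completions would give another optimal \<open>\<gamma>\<close> with smaller
  excess over the same \<open>\<delta>\<close>.\<close>

lemma closest_optimal_pair:
  obtains \<gamma> \<delta> where "\<gamma> \<in> Delta E n" "a (padd \<alpha> \<gamma>) = top_value E a \<alpha> n" "\<delta> \<in> Delta E m" "a (padd \<beta> \<delta>) = top_value E a \<beta> m"
    "\<And>\<gamma>'. \<gamma>' \<in> Delta E n \<Longrightarrow> a (padd \<alpha> \<gamma>') = top_value E a \<alpha> n \<Longrightarrow> excess E \<gamma> \<delta> \<le> excess E \<gamma>' \<delta>"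
proof -
  obtain \<delta> where d: "\<delta> \<in> Delta E m" "a (padd \<beta> \<delta>) = top_value E a \<beta> m" by (rule top_value_attained)
  obtain \<gamma>0 where g0: "\<gamma>0 \<in> Delta E n" "a (padd \<alpha> \<gamma>0) = top_value E a \<alpha> n" by (rule top_value_attained)
  obtain \<gamma> where "\<gamma> \<in> Delta E n \<and> a (padd \<alpha> \<gamma>) = top_value E a \<alpha> n"
    "\<And>\<gamma>'. \<gamma>' \<in> Delta E n \<and> a (padd \<alpha> \<gamma>') = top_value E a \<alpha> n \<Longrightarrow> excess E \<gamma> \<delta> \<le> excess E \<gamma>' \<delta>"
    using ex_has_least_nat[of "\<lambda>\<gamma>. \<gamma> \<in> Delta E n \<and> a (padd \<alpha> \<gamma>) = top_value E a \<alpha> n" \<gamma>0 "\<lambda>\<gamma>. excess E \<gamma> \<delta>"] g0 by auto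
  then show thesis using that d by blast
qed

text \<open>The exchange at the added coordinate. The larger completion exceeds the other at some
  \<open>s\<close>; for a closest optimal pair the unit at \<open>s\<close> cannot be returned
  inside the completions, so it is returned where \<open>\<beta>\<close> exceeds
  \<open>\<alpha>\<close>.\<close>

lemma top_value_exchange_slack:
  assumes al: "\<alpha> \<in> Delta E k" "k + n = r" and be: "\<beta> \<in> Delta E l" "l + m = r" and "m < n"
  shows "\<exists>t\<in>E. \<alpha> t < \<beta> t \<and> top_value E a \<alpha> n * top_value E a \<beta> m \<le> top_value E a (inc t \<alpha>) (n - 1) * top_value E a (dec t \<beta>) (Suc m)"
proof (cases "0 < top_value E a \<alpha> n * top_value E a \<beta> m")
  case False
  obtain t where t: "t \<in> E" "\<alpha> t < \<beta> t" using Delta_less_ex[OF al(1) be(1)] assms by force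
  obtain l' where l': "l = Suc l'" using assms by (cases l) auto
  have "inc t \<alpha> \<in> Delta E (Suc k)" "dec t \<beta> \<in> Delta E l'"
    using t al be l' E dec_in_Delta[of E \<beta> l' t] by (auto simp: inc_in_Delta_iff)
  moreover have "Suc k + (n - 1) = r" "l' + Suc m = r" using al be l' \<open>m < n\<close> by auto
  ultimately have "0 \<le> top_value E a (inc t \<alpha>) (n - 1)" "0 \<le> top_value E a (dec t \<beta>) (Suc m)"
    using top_value_nonneg by blast+
  then have "0 \<le> top_value E a (inc t \<alpha>) (n - 1) * top_value E a (dec t \<beta>) (Suc m)" by simp
  then show ?thesis using t False by (intro bexI[of _ t]) auto
next
  case pos: True
  obtain \<gamma> \<delta> where g: "\<gamma> \<in> Delta E n" "a (padd \<alpha> \<gamma>) = top_value E a \<alpha> n" and d: "\<delta> \<in> Delta E m" "a (padd \<beta> \<delta>) = top_value E a \<beta> m"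
    and least: "\<And>\<gamma>'. \<gamma>' \<in> Delta E n \<Longrightarrow> a (padd \<alpha> \<gamma>') = top_value E a \<alpha> n \<Longrightarrow> excess E \<gamma> \<delta> \<le> excess E \<gamma>' \<delta>"
    using closest_optimal_pair[where n = n and \<alpha> = \<alpha> and m = m and \<beta> = \<beta>] by blast
  obtain s where s: "s \<in> E" "\<delta> s < \<gamma> s" using Delta_less_ex[OF d(1) g(1) \<open>m < n\<close>] by auto
  have D: "padd \<gamma> \<alpha> \<in> Delta E r" "padd \<delta> \<beta> \<in> Delta E r"
    using padd_in_Delta[OF g(1) al(1)] padd_in_Delta[OF d(1) be(1)] al be by (simp_all add: add.commute)
  obtain n' l' where n': "n = Suc n'" "l = Suc l'" using assms by (cases n; cases l) auto
  have prod: "a (padd \<gamma> \<alpha>) * a (padd \<delta> \<beta>) = top_value E a \<alpha> n * top_value E a \<beta> m" using g d by (simp add: padd_commute)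
  from D s(2) show ?thesis
  proof (cases rule: split_exchange)
    case (same t)
    have in': "inc t (dec s \<gamma>) \<in> Delta E n" "inc s (dec t \<delta>) \<in> Delta E m"
      using exchange_in_Delta[OF E(1) g(1)] exchange_in_Delta[OF E(1) d(1)] s same by auto
    then have "a (padd \<alpha> (inc t (dec s \<gamma>))) = top_value E a \<alpha> n"
      using product_maximal[OF padd_nonneg[OF al(1) in'(1) al(2)] top_value_ge[OF in'(1)]
          padd_nonneg[OF be(1) in'(2) be(2)] top_value_ge[OF in'(2)] _ pos] same(3) prod
      by (simp add: padd_commute)
    then show ?thesis
      using least[of "inc t (dec s \<gamma>)"] excess_exchange[OF E(1) s same(2)] in'(1) by simp
  next
    case (other t)
    have "a (padd (inc t \<alpha>) (dec s \<gamma>)) * a (padd (dec t \<beta>) (inc s \<delta>)) \<le> top_value E a (inc t \<alpha>) n' * top_value E a (dec t \<beta>) (Suc m)"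
      by (rule product_le_top[of _ "Suc k" _ _ _ l'])
         (use al be g d n' s other E dec_in_Delta[OF E(1), of \<gamma> n' s] dec_in_Delta[OF E(1), of \<beta> l' t] in \<open>auto simp: inc_in_Delta_iff\<close>)
    then show ?thesis using other prod n' by (intro bexI[of _ t]) (auto simp: padd_commute)
  qed
qed

text \<open>Suppose both alternatives fail. Then every optimal pair for \<open>(\<alpha>, \<beta>)\<close> yields an optimal pair for
  \<open>(\<alpha> - e\<^sub>s, \<beta> + e\<^sub>s)\<close>, and a pair of the latter kind with least excess can be moved back at every
  coordinate where \<open>\<gamma>\<close> exceeds \<open>\<delta>\<close>. Moving back \<open>\<delta>\<close> at \<open>t1\<close> and \<open>\<gamma>\<close> at \<open>t2\<close>, and then forward
  again, decreases the excess.\<close>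
lemma top_value_exchange:
  assumes al: "\<alpha> \<in> Delta E k" "k + n = r" and be: "\<beta> \<in> Delta E l" "l + m = r" and s: "\<beta> s < \<alpha> s"
  shows "(\<exists>t\<in>E. \<alpha> t < \<beta> t \<and> top_value E a \<alpha> n * top_value E a \<beta> m \<le> top_value E a (inc t (dec s \<alpha>)) n * top_value E a (inc s (dec t \<beta>)) m) \<or>
    (n < m \<and> top_value E a \<alpha> n * top_value E a \<beta> m \<le> top_value E a (dec s \<alpha>) (Suc n) * top_value E a (inc s \<beta>) (m - 1))"
proof (rule ccontr)
  assume neg: "\<not> ?thesis"
  define B where "B = top_value E a \<alpha> n * top_value E a \<beta> m"
  define B' where "B' = top_value E a (dec s \<alpha>) (Suc n) * top_value E a (inc s \<beta>) (m - 1)"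
  have sE: "s \<in> E" using Delta_outside[OF al(1), of s] s by simp
  obtain k' where k': "k = Suc k'"
    using al s sE E by (cases k) (auto simp: Delta_def)
  have al': "dec s \<alpha> \<in> Delta E k'" using dec_in_Delta[OF E(1)] al k' s by auto
  have be': "inc s \<beta> \<in> Delta E (Suc l)" using be sE E by (simp add: inc_in_Delta_iff)
  have neg1: "top_value E a (inc t (dec s \<alpha>)) n * top_value E a (inc s (dec t \<beta>)) m < B" if "t \<in> E" "\<alpha> t < \<beta> t" for t
    using neg that by (auto simp: B_def not_le)
  have step: "\<exists>t\<in>E. \<gamma> t < \<delta> t \<and> B \<le> a (padd (dec s \<alpha>) (inc t \<gamma>)) * a (padd (inc s \<beta>) (dec t \<delta>))"
    if g: "\<gamma> \<in> Delta E n" "a (padd \<alpha> \<gamma>) = top_value E a \<alpha> n" and d: "\<delta> \<in> Delta E m" "a (padd \<beta> \<delta>) = top_value E a \<beta> m" for \<gamma> \<delta>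
  proof -
    have D: "padd \<alpha> \<gamma> \<in> Delta E r" "padd \<beta> \<delta> \<in> Delta E r"
      using padd_in_Delta[OF al(1) g(1)] padd_in_Delta[OF be(1) d(1)] al be by simp_all
    from D s show ?thesis
    proof (cases rule: split_exchange)
      case (same t)
      have "inc t (dec s \<alpha>) \<in> Delta E k" "inc s (dec t \<beta>) \<in> Delta E l"
        using exchange_in_Delta[OF E(1) al(1)] exchange_in_Delta[OF E(1) be(1)] s sE same by auto
      from product_le_top[OF this(1) al(2) g(1) this(2) be(2) d(1)] show ?thesis
        using neg1[OF same(1,2)] same(3) g d by (simp add: B_def)
    next
      case (other t)
      then show ?thesis using g d by (auto simp: B_def)
    qed
  qed
  obtain \<gamma>0 where g0: "\<gamma>0 \<in> Delta E n" "a (padd \<alpha> \<gamma>0) = top_value E a \<alpha> n" by (rule top_value_attained)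
  obtain \<delta>0 where d0: "\<delta>0 \<in> Delta E m" "a (padd \<beta> \<delta>0) = top_value E a \<beta> m" by (rule top_value_attained)
  from step[OF g0 d0] obtain t0 where t0: "t0 \<in> E" "\<gamma>0 t0 < \<delta>0 t0"
    "B \<le> a (padd (dec s \<alpha>) (inc t0 \<gamma>0)) * a (padd (inc s \<beta>) (dec t0 \<delta>0))" by auto
  obtain m' where m': "m = Suc m'" using d0 t0 E by (cases m) (auto simp: Delta_def)
  have sums: "k' + Suc n = r" "Suc l + m' = r" using al be k' m' by auto
  have "a (padd (dec s \<alpha>) (inc t0 \<gamma>0)) * a (padd (inc s \<beta>) (dec t0 \<delta>0)) \<le> B'"
    unfolding B'_def m' diff_Suc_1
    by (rule product_le_top[OF al' sums(1) _ be' sums(2)])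
       (use g0 d0 t0 m' E dec_in_Delta[OF E(1), of \<delta>0 m' t0] in \<open>auto simp: inc_in_Delta_iff\<close>)
  then have BB': "B \<le> B'" using t0(3) by simp
  \<comment> \<open>The second alternative fails although \<open>B \<le> B'\<close>, so
    \<open>n < m\<close> is false. Hence the \<open>\<gamma>\<close> chosen below has total degree
    at least two above that of \<open>\<delta>\<close>, leaving room for both \<open>t1\<close> and
    \<open>t2\<close>.\<close>
  then have mn: "m \<le> n" using neg by (auto simp: B_def B'_def)
  have Bpos: "0 < B"
  proof -
    have "k \<le> l" using mn al be by simp
    from Delta_le_ex[OF E(1) al(1) be(1) this s] obtain t where t: "t \<in> E" "\<alpha> t < \<beta> t" by auto
    have "inc t (dec s \<alpha>) \<in> Delta E k" "inc s (dec t \<beta>) \<in> Delta E l"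
      using exchange_in_Delta[OF E(1) al(1)] exchange_in_Delta[OF E(1) be(1)] s sE t by auto
    then have "0 \<le> top_value E a (inc t (dec s \<alpha>)) n * top_value E a (inc s (dec t \<beta>)) m"
      using top_value_nonneg al be by (intro mult_nonneg_nonneg) blast+
    then show ?thesis using neg1[OF t] by simp
  qed
  obtain \<gamma> \<delta> where g: "\<gamma> \<in> Delta E (Suc n)" "a (padd (dec s \<alpha>) \<gamma>) = top_value E a (dec s \<alpha>) (Suc n)"
    and d: "\<delta> \<in> Delta E m'" "a (padd (inc s \<beta>) \<delta>) = top_value E a (inc s \<beta>) m'"
    and least: "\<And>\<gamma>'. \<gamma>' \<in> Delta E (Suc n) \<Longrightarrow> a (padd (dec s \<alpha>) \<gamma>') = top_value E a (dec s \<alpha>) (Suc n) \<Longrightarrow>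
      excess E \<gamma> \<delta> \<le> excess E \<gamma>' \<delta>"
    using closest_optimal_pair[where n = "Suc n" and \<alpha> = "dec s \<alpha>" and m = m' and \<beta> = "inc s \<beta>"]
    by blast
  have prod': "a (padd \<gamma> (dec s \<alpha>)) * a (padd \<delta> (inc s \<beta>)) = B'"
    using g d m' by (simp add: padd_commute B'_def)
  \<comment> \<open>Exchanging at \<open>t\<close>, the case \<open>same\<close> contradicts least
    excess and \<open>other\<close> with \<open>u \<noteq> s\<close> contradicts
    \<open>neg1\<close>; only \<open>u = s\<close> remains, which undoes the move at
    \<open>s\<close>.\<close>
  have retreat: "B = B' \<and> a (padd \<alpha> (dec t \<gamma>)) = top_value E a \<alpha> n \<and> a (padd \<beta> (inc t \<delta>)) = top_value E a \<beta> m"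
    if t: "t \<in> E" "\<delta> t < \<gamma> t" for t
  proof -
    have D: "padd \<gamma> (dec s \<alpha>) \<in> Delta E r" "padd \<delta> (inc s \<beta>) \<in> Delta E r"
      using padd_in_Delta[OF g(1) al'] padd_in_Delta[OF d(1) be'] sums by (simp_all add: add.commute)
    have dg: "dec t \<gamma> \<in> Delta E n" "inc t \<delta> \<in> Delta E m"
      using dec_in_Delta[OF E(1) g(1)] t d m' E by (auto simp: inc_in_Delta_iff)
    from D t(2) show ?thesis
    proof (cases rule: split_exchange)
      case (same u)
      have in': "inc u (dec t \<gamma>) \<in> Delta E (Suc n)" "inc t (dec u \<delta>) \<in> Delta E m'"
        using exchange_in_Delta[OF E(1) g(1)] exchange_in_Delta[OF E(1) d(1)] t same by auto
      have "0 < top_value E a (dec s \<alpha>) (Suc n) * top_value E a (inc s \<beta>) m'"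
        using Bpos BB' m' by (simp add: B'_def)
      then have "a (padd (dec s \<alpha>) (inc u (dec t \<gamma>))) = top_value E a (dec s \<alpha>) (Suc n)"
        using product_maximal[OF padd_nonneg[OF al' in'(1) sums(1)] top_value_ge[OF in'(1)]
            padd_nonneg[OF be' in'(2) sums(2)] top_value_ge[OF in'(2)]] same(3) prod' m'
        by (simp add: B'_def padd_commute)
      then show ?thesis
        using least[OF in'(1)] excess_exchange[OF E(1) t same(2)] by simp
    next
      case (other u)
      show ?thesis
      proof (cases "u = s")
        case True
        have "inc s (dec s \<alpha>) = \<alpha>" "dec s (inc s \<beta>) = \<beta>" using s by (auto simp: inc_dec)
        then have le: "B' \<le> a (padd \<alpha> (dec t \<gamma>)) * a (padd \<beta> (inc t \<delta>))"
          using other(3) prod' True by (simp add: padd_commute)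
        have "a (padd \<alpha> (dec t \<gamma>)) = top_value E a \<alpha> n \<and> a (padd \<beta> (inc t \<delta>)) = top_value E a \<beta> m"
          using product_maximal[OF padd_nonneg[OF al(1) dg(1) al(2)] top_value_ge[OF dg(1)]
            padd_nonneg[OF be(1) dg(2) be(2)] top_value_ge[OF dg(2)]] le BB' Bpos by (simp add: B_def)
        then show ?thesis using le BB' by (simp add: B_def)
      next
        case False
        then have u: "\<alpha> u < \<beta> u" using other(2) by simp
        have "inc u (dec s \<alpha>) \<in> Delta E k" "inc s (dec u \<beta>) \<in> Delta E l"
          using exchange_in_Delta[OF E(1) al(1)] exchange_in_Delta[OF E(1) be(1)] s sE other u by auto
        from product_le_top[OF this(1) al(2) dg(1) this(2) be(2) dg(2)]
        show ?thesis using neg1[OF other(1) u] other(3) prod' BB' False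
          by (simp add: padd_commute dec_inc_commute)
      qed
    qed
  qed
  obtain t1 where t1: "t1 \<in> E" "\<delta> t1 < \<gamma> t1"
    using Delta_less_ex[OF d(1) g(1)] mn m' by auto
  have d1: "inc t1 \<delta> \<in> Delta E m" using d m' t1 E by (simp add: inc_in_Delta_iff)
  \<comment> \<open>\<open>t2\<close> is chosen after raising \<open>\<delta>\<close> at
    \<open>t1\<close>, and may equal \<open>t1\<close>; this makes the later \<open>t\<close> differ
    from both, whence \<open>\<gamma> t < \<delta> t\<close>.\<close>
  obtain t2 where t2: "t2 \<in> E" "inc t1 \<delta> t2 < \<gamma> t2"
    using Delta_less_ex[OF d1 g(1)] mn by auto
  then have t2': "\<delta> t2 < \<gamma> t2" by (auto simp: inc_def split: if_splits)
  have g1: "dec t2 \<gamma> \<in> Delta E n" using dec_in_Delta[OF E(1) g(1), of t2] t2 by simp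
  \<comment> \<open>Optimality concerns each member separately, so the two retreats, at different
    coordinates, may be combined into one optimal pair.\<close>
  from step[OF g1 _ d1] retreat[OF t1] retreat[OF t2(1) t2'] obtain t where t: "t \<in> E" "dec t2 \<gamma> t < inc t1 \<delta> t"
    and tB: "B' \<le> a (padd (dec s \<alpha>) (inc t (dec t2 \<gamma>))) * a (padd (inc s \<beta>) (dec t (inc t1 \<delta>)))"
    by auto
  have "t \<noteq> t2" "t \<noteq> t1" using t t1 t2 t2' by (auto simp: inc_def dec_def split: if_splits)
  then have gt: "\<gamma> t < \<delta> t" using t by simp
  have in': "inc t (dec t2 \<gamma>) \<in> Delta E (Suc n)" "dec t (inc t1 \<delta>) \<in> Delta E m'"
    using exchange_in_Delta[OF E(1) g(1), of t2 t] t2 t1 t dec_in_Delta[OF E(1), of "inc t1 \<delta>" m' t] d1 m' gt \<open>t \<noteq> t1\<close> by auto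
  have "0 < top_value E a (dec s \<alpha>) (Suc n) * top_value E a (inc s \<beta>) m'"
    using Bpos BB' m' by (simp add: B'_def)
  then have "a (padd (dec s \<alpha>) (inc t (dec t2 \<gamma>))) = top_value E a (dec s \<alpha>) (Suc n)"
    using product_maximal[OF padd_nonneg[OF al' in'(1) sums(1)] top_value_ge[OF in'(1)]
        padd_nonneg[OF be' in'(2) sums(2)] top_value_ge[OF in'(2)]] tB m'
    by (simp add: B'_def)
  then show False using least[OF in'(1)] excess_exchange[OF E(1) t2(1) t2' gt] by simp
qed

section \<open>Exchange with the added coordinate\<close>

lemma Delta_option:
  assumes "h \<in> Delta (insert None (Some ` E)) d"
  obtains k where "h \<circ> Some \<in> Delta E k" "k + h None = d"
proof -
  have "(\<Sum>e\<in>insert None (Some ` E). h e) = h None + (\<Sum>e\<in>E. h (Some e))"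
    using E by (simp add: sum.reindex)
  moreover have "h (Some e) = 0" if "e \<notin> E" for e using assms that by (auto simp: Delta_def)
  ultimately show thesis
    using that[of "\<Sum>e\<in>E. h (Some e)"] assms by (auto simp: Delta_def)
qed

lemma inc_option:
  "inc (Some e) h \<circ> Some = inc e (h \<circ> Some)" "inc None h \<circ> Some = h \<circ> Some"
  "dec (Some e) h \<circ> Some = dec e (h \<circ> Some)" "dec None h \<circ> Some = h \<circ> Some"
  by (auto simp: fun_eq_iff inc_def dec_def)

lemma exchange_fun_homogenization:
  "exchange_fun (insert None (Some ` E)) r (homogenization E a)"
  unfolding exchange_fun_def
proof (intro conjI ballI impI)
  fix h assume "h \<in> Delta (insert None (Some ` E)) r"
  then obtain k where "h \<circ> Some \<in> Delta E k" "k + h None = r" by (rule Delta_option)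
  then show "0 \<le> homogenization E a h" unfolding homogenization_def by (rule top_value_nonneg)
next
  fix h g s assume h: "h \<in> Delta (insert None (Some ` E)) r" and g: "g \<in> Delta (insert None (Some ` E)) r"
    and s: "s \<in> insert None (Some ` E)" "g s < h s"
  obtain k where k: "h \<circ> Some \<in> Delta E k" "k + h None = r" using h by (rule Delta_option)
  obtain l where l: "g \<circ> Some \<in> Delta E l" "l + g None = r" using g by (rule Delta_option)
  show "\<exists>t\<in>insert None (Some ` E). h t < g t \<and>
      homogenization E a h * homogenization E a g \<le> homogenization E a (inc t (dec s h)) * homogenization E a (inc s (dec t g))"
  proof (cases s)
    case None
    with top_value_exchange_slack[OF k l] s obtain t where "t \<in> E" "(h \<circ> Some) t < (g \<circ> Some) t"
      "top_value E a (h \<circ> Some) (h None) * top_value E a (g \<circ> Some) (g None) \<le>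
        top_value E a (inc t (h \<circ> Some)) (h None - 1) * top_value E a (dec t (g \<circ> Some)) (Suc (g None))" by auto
    then show ?thesis using None
      by (intro bexI[of _ "Some t"]) (auto simp: homogenization_def inc_option)
  next
    case (Some u)
    then have "(g \<circ> Some) u < (h \<circ> Some) u" using s by simp
    from top_value_exchange[OF k l this] show ?thesis
    proof
      assume "\<exists>t\<in>E. (h \<circ> Some) t < (g \<circ> Some) t \<and>
        top_value E a (h \<circ> Some) (h None) * top_value E a (g \<circ> Some) (g None) \<le>
        top_value E a (inc t (dec u (h \<circ> Some))) (h None) * top_value E a (inc u (dec t (g \<circ> Some))) (g None)"
      then obtain t where "t \<in> E" "(h \<circ> Some) t < (g \<circ> Some) t"
        "top_value E a (h \<circ> Some) (h None) * top_value E a (g \<circ> Some) (g None) \<le>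
        top_value E a (inc t (dec u (h \<circ> Some))) (h None) * top_value E a (inc u (dec t (g \<circ> Some))) (g None)" by auto
      then show ?thesis using Some
        by (intro bexI[of _ "Some t"]) (auto simp: homogenization_def inc_option)
    next
      assume "h None < g None \<and> top_value E a (h \<circ> Some) (h None) * top_value E a (g \<circ> Some) (g None) \<le>
        top_value E a (dec u (h \<circ> Some)) (Suc (h None)) * top_value E a (inc u (g \<circ> Some)) (g None - 1)"
      then show ?thesis using Some
        by (intro bexI[of _ None]) (auto simp: homogenization_def inc_option)
    qed
  qed
qed

end

section \<open>The generating polynomial of an M-convex function\<close>

text \<open>For \<open>\<alpha> = \<beta> + e_e\<close> one has
  \<open>1 / \<beta>! = \<alpha>_e / \<alpha>!\<close>, and the indices not of this form have
  \<open>\<alpha>_e = 0\<close>.\<close>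

lemma sum_Delta_Suc:
  fixes f :: "('e \<Rightarrow> nat) \<Rightarrow> real"
  assumes E: "finite E" "e \<in> E"
  shows "(\<Sum>\<beta>\<in>Delta E d. f (inc e \<beta>) / (\<Prod>x\<in>E. fact (\<beta> x))) =
    (\<Sum>\<alpha>\<in>Delta E (Suc d). real (\<alpha> e) * f \<alpha> / (\<Prod>x\<in>E. fact (\<alpha> x)))"
proof -
  have "(\<Sum>\<alpha>\<in>Delta E (Suc d). real (\<alpha> e) * f \<alpha> / (\<Prod>x\<in>E. fact (\<alpha> x))) =
      (\<Sum>\<alpha>\<in>inc e ` Delta E d. real (\<alpha> e) * f \<alpha> / (\<Prod>x\<in>E. fact (\<alpha> x)))"
  proof (rule sum.mono_neutral_right[OF finite_Delta[OF E(1)]])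
    show "inc e ` Delta E d \<subseteq> Delta E (Suc d)" using E by (auto simp: inc_in_Delta_iff)
    show "\<forall>\<alpha>\<in>Delta E (Suc d) - inc e ` Delta E d. real (\<alpha> e) * f \<alpha> / (\<Prod>x\<in>E. fact (\<alpha> x)) = 0"
    proof
      fix \<alpha> assume al: "\<alpha> \<in> Delta E (Suc d) - inc e ` Delta E d"
      have "\<alpha> e = 0"
      proof (rule ccontr)
        assume "\<alpha> e \<noteq> 0"
        then have "dec e \<alpha> \<in> Delta E d" "\<alpha> = inc e (dec e \<alpha>)"
          using al dec_in_Delta[OF E(1), of \<alpha> d e] by (auto simp: inc_dec)
        then show False using al by blast
      qed
      then show "real (\<alpha> e) * f \<alpha> / (\<Prod>x\<in>E. fact (\<alpha> x)) = 0" by simp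
    qed
  qed
  also have "\<dots> = (\<Sum>\<beta>\<in>Delta E d. real (inc e \<beta> e) * f (inc e \<beta>) / (\<Prod>x\<in>E. fact (inc e \<beta> x)))"
    by (rule sum.reindex_cong[OF _ refl]) (metis dec_inc inj_onI, simp)
  also have "\<dots> = (\<Sum>\<beta>\<in>Delta E d. f (inc e \<beta>) / (\<Prod>x\<in>E. fact (\<beta> x)))"
  proof (intro sum.cong refl)
    fix \<beta>
    have "(\<Prod>x\<in>E - {e}. fact (inc e \<beta> x)) = (\<Prod>x\<in>E - {e}. fact (\<beta> x) :: real)"
      by (intro prod.cong) auto
    then have "(\<Prod>x\<in>E. fact (inc e \<beta> x)) = real (Suc (\<beta> e)) * (\<Prod>x\<in>E. fact (\<beta> x))"
      using prod.remove[OF E, of "\<lambda>x. fact (inc e \<beta> x) :: real"] prod.remove[OF E, of "\<lambda>x. fact (\<beta> x) :: real"]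
      by simp
    then show "real (inc e \<beta> e) * f (inc e \<beta>) / (\<Prod>x\<in>E. fact (inc e \<beta> x)) =
        f (inc e \<beta>) / (\<Prod>x\<in>E. fact (\<beta> x))"
      by (simp del: of_nat_Suc)
  qed
  finally show ?thesis by simp
qed

lemma genpoly_eq_sum:
  assumes E: "finite E" and w: "w None = 0" "\<And>e. e \<in> E \<Longrightarrow> w (Some e) = 1"
  shows "genpoly w (insert None (Some ` E)) d c =
    fact d * (\<Sum>\<alpha>\<in>Delta E d. c (case_option 0 \<alpha>) / (\<Prod>e\<in>E. fact (\<alpha> e)))"
proof (induction d arbitrary: c)
  case 0
  have D: "Delta E 0 = {\<lambda>_. 0}" using E by (auto simp: Delta_def fun_eq_iff)
  have z: "case_option 0 (\<lambda>_. 0) = (\<lambda>_. 0 :: nat)" by (auto simp: fun_eq_iff split: option.split)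
  show ?case unfolding D genpoly.simps by (simp add: z)
next
  case (Suc d)
  let ?F = "\<lambda>\<alpha>. (\<Prod>e\<in>E. fact (\<alpha> e)) :: real"
  have lift: "inc (Some e) (case_option 0 \<beta>) = case_option 0 (inc e \<beta>)" for e and \<beta> :: "'a \<Rightarrow> nat"
    by (auto simp: fun_eq_iff inc_def split: option.split)
  have "genpoly w (insert None (Some ` E)) (Suc d) c =
      (\<Sum>e\<in>E. genpoly w (insert None (Some ` E)) d (shift (Some e) c))"
    using E w by (simp add: sum.reindex)
  also have "\<dots> = fact d * (\<Sum>e\<in>E. \<Sum>\<beta>\<in>Delta E d. c (case_option 0 (inc e \<beta>)) / ?F \<beta>)"
    by (simp add: Suc lift sum_distrib_left)
  also have "(\<Sum>e\<in>E. \<Sum>\<beta>\<in>Delta E d. c (case_option 0 (inc e \<beta>)) / ?F \<beta>) =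
      (\<Sum>e\<in>E. \<Sum>\<alpha>\<in>Delta E (Suc d). real (\<alpha> e) * c (case_option 0 \<alpha>) / ?F \<alpha>)"
    by (intro sum.cong refl sum_Delta_Suc[OF E])
  \<comment> \<open>The multiplicities \<open>\<alpha> e\<close> add up to \<open>Suc d\<close>,
    which turns \<open>d!\<close> into \<open>(d + 1)!\<close>.\<close>
  also have "\<dots> = (\<Sum>\<alpha>\<in>Delta E (Suc d). real (\<Sum>e\<in>E. \<alpha> e) * (c (case_option 0 \<alpha>) / ?F \<alpha>))"
    by (subst sum.swap) (simp add: sum_distrib_right sum_divide_distrib)
  also have "\<dots> = (\<Sum>\<alpha>\<in>Delta E (Suc d). real (Suc d) * (c (case_option 0 \<alpha>) / ?F \<alpha>))"
    by (intro sum.cong refl) (simp add: Delta_def)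
  also have "\<dots> = real (Suc d) * (\<Sum>\<alpha>\<in>Delta E (Suc d). c (case_option 0 \<alpha>) / ?F \<alpha>)"
    by (simp add: sum_distrib_left)
  finally show ?case by (simp add: mult_ac)
qed

section \<open>From valuations to exchange functions\<close>

lemma qpow_antimono:
  assumes "0 < q" "q \<le> 1" "x \<le> y" "x \<noteq> -\<infinity>"
  shows "qpow q y \<le> qpow q x"
proof (cases "y = \<infinity>")
  case True
  then show ?thesis by (simp add: qpow_def)
next
  case False
  \<comment> \<open>Excluding \<open>-\<infinity>\<close> matters: \<open>real_of_ereal\<close>
    sends it to \<open>0\<close>, so \<open>qpow\<close> would be \<open>1\<close> there, possibly
    less than \<open>qpow q y\<close>.\<close>
  then obtain s t where "x = ereal s" "y = ereal t" "s \<le> t"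
    using assms by (cases x; cases y) auto
  then show ?thesis using assms powr_mono'[of s t q] by (simp add: qpow_def)
qed

lemma qpow_add:
  assumes "x \<noteq> -\<infinity>" "y \<noteq> -\<infinity>"
  shows "qpow q (x + y) = qpow q x * qpow q y"
  using assms by (cases x; cases y) (auto simp: qpow_def powr_add)

lemma M_convex_not_MInf: "M_convex G E r \<nu> \<Longrightarrow> \<alpha> \<in> Delta E r \<Longrightarrow> \<nu> \<alpha> \<noteq> -\<infinity>"
  by (auto simp: M_convex_def)

lemma M_convex_exchange_fun:
  assumes E: "finite E" and \<nu>: "M_convex G E r \<nu>" and q: "0 < q" "q \<le> 1"
  shows "exchange_fun E r (\<lambda>\<alpha>. qpow q (\<nu> \<alpha>))"
  unfolding exchange_fun_def
proof (intro conjI ballI impI)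
  show "0 \<le> qpow q (\<nu> \<alpha>)" for \<alpha> by (simp add: qpow_def)
next
  fix \<alpha> \<beta> s assume h: "\<alpha> \<in> Delta E r" "\<beta> \<in> Delta E r" "s \<in> E" "\<beta> s < \<alpha> s"
  have eq: "(\<lambda>e. \<alpha> e - unitv s e + unitv t e) = inc t (dec s \<alpha>)" for \<alpha> :: "'a \<Rightarrow> nat" and s t
    by (auto simp: fun_eq_iff unitv_def inc_def dec_def)
  obtain t where t: "t \<in> E" "\<alpha> t < \<beta> t"
    "\<nu> (inc t (dec s \<alpha>)) + \<nu> (inc s (dec t \<beta>)) \<le> \<nu> \<alpha> + \<nu> \<beta>"
    using \<nu> h unfolding M_convex_def eq by blast
  have D: "inc t (dec s \<alpha>) \<in> Delta E r" "inc s (dec t \<beta>) \<in> Delta E r"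
    using exchange_in_Delta[OF E h(1)] exchange_in_Delta[OF E h(2)] h t by auto
  have fin: "\<nu> (inc t (dec s \<alpha>)) \<noteq> -\<infinity>" "\<nu> (inc s (dec t \<beta>)) \<noteq> -\<infinity>" "\<nu> \<alpha> \<noteq> -\<infinity>" "\<nu> \<beta> \<noteq> -\<infinity>"
    using M_convex_not_MInf[OF \<nu>] D h by auto
  then have "qpow q (\<nu> \<alpha> + \<nu> \<beta>) \<le> qpow q (\<nu> (inc t (dec s \<alpha>)) + \<nu> (inc s (dec t \<beta>)))"
    using q t(3) by (intro qpow_antimono) auto
  then show "\<exists>t\<in>E. \<alpha> t < \<beta> t \<and>
      qpow q (\<nu> \<alpha>) * qpow q (\<nu> \<beta>) \<le> qpow q (\<nu> (inc t (dec s \<alpha>))) * qpow q (\<nu> (inc s (dec t \<beta>)))"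
    using t fin by (auto simp: qpow_add)
qed

lemma qpow_nu_tilde:
  assumes E: "finite E" "E \<noteq> {}" and \<nu>: "M_convex G E r \<nu>" and q: "0 < q" "q \<le> 1"
    and al: "\<alpha> \<in> Delta E j" "j \<le> r"
  shows "qpow q (nu_tilde E r \<nu> \<alpha>) = top_value E (\<lambda>\<alpha>. qpow q (\<nu> \<alpha>)) \<alpha> (r - j)"
proof -
  define S where "S = (\<lambda>\<gamma>. \<nu> (padd \<alpha> \<gamma>)) ` Delta E (r - j)"
  have D: "padd \<alpha> \<gamma> \<in> Delta E r" if "\<gamma> \<in> Delta E (r - j)" for \<gamma>
    using padd_in_Delta[OF al(1) that] al by simp
  have "{\<nu> \<beta> | \<beta>. \<beta> \<in> Delta E r \<and> (\<forall>e\<in>E. \<alpha> e \<le> \<beta> e)} = S"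
  proof (intro equalityI subsetI)
    fix x assume "x \<in> {\<nu> \<beta> | \<beta>. \<beta> \<in> Delta E r \<and> (\<forall>e\<in>E. \<alpha> e \<le> \<beta> e)}"
    then obtain \<beta> where b: "x = \<nu> \<beta>" "\<beta> \<in> Delta E r" "\<forall>e\<in>E. \<alpha> e \<le> \<beta> e" by auto
    \<comment> \<open>The order is given on \<open>E\<close> only; off \<open>E\<close> both indices
      vanish, so \<open>\<beta> - \<alpha>\<close> is a genuine completion.\<close>
    have le: "\<alpha> e \<le> \<beta> e" for e using b al by (cases "e \<in> E") (auto simp: Delta_def)
    have "(\<lambda>e. \<beta> e - \<alpha> e) \<in> Delta E (r - j)"
      using b al le by (simp add: Delta_def sum_subtractf_nat)
    moreover have "padd \<alpha> (\<lambda>e. \<beta> e - \<alpha> e) = \<beta>" using le by (simp add: padd_def)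
    ultimately show "x \<in> S" unfolding S_def using b(1) by (intro image_eqI[of _ _ "\<lambda>e. \<beta> e - \<alpha> e"]) simp_all
  next
    fix x assume "x \<in> S"
    then obtain \<gamma> where "\<gamma> \<in> Delta E (r - j)" "x = \<nu> (padd \<alpha> \<gamma>)" by (auto simp: S_def)
    moreover have "\<forall>e\<in>E. \<alpha> e \<le> padd \<alpha> \<gamma> e" by (simp add: padd_def)
    ultimately show "x \<in> {\<nu> \<beta> | \<beta>. \<beta> \<in> Delta E r \<and> (\<forall>e\<in>E. \<alpha> e \<le> \<beta> e)}"
      using D by blast
  qed
  then have nt: "nu_tilde E r \<nu> \<alpha> = Min S" by (simp add: nu_tilde_def)
  have S: "finite S" "S \<noteq> {}"
    using finite_Delta[OF E(1)] Delta_nonempty[OF E] by (auto simp: S_def)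
  have ninf: "x \<noteq> -\<infinity>" if "x \<in> S" for x
    using that D M_convex_not_MInf[OF \<nu>] by (auto simp: S_def)
  have "Max (qpow q ` S) = qpow q (Min S)"
  proof (rule Max_eqI)
    show "finite (qpow q ` S)" using S by simp
    show "qpow q (Min S) \<in> qpow q ` S" using S by simp
    show "y \<le> qpow q (Min S)" if "y \<in> qpow q ` S" for y
      using that S ninf[OF Min_in[OF S]] by (auto intro!: qpow_antimono[OF q])
  qed
  then show ?thesis by (simp add: nt top_value_def S_def image_image)
qed

lemma exchange_fun_funpow_shift:
  assumes "finite I" "i \<in> I" "exchange_fun I (n + m) a"
  shows "exchange_fun I m ((shift i ^^ n) a)"
  using assms(3)
proof (induction n arbitrary: m)
  case (Suc n)
  have "exchange_fun I (Suc m) ((shift i ^^ n) a)" using Suc.prems by (intro Suc.IH) simp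
  then show ?case unfolding funpow.simps comp_apply by (rule exchange_fun_shift[OF assms(1,2)])
qed simp

lemma funpow_shift: "(shift i ^^ n) a \<alpha> = a (\<alpha>(i := \<alpha> i + n))"
  by (induction n arbitrary: \<alpha>) (simp_all add: inc_def)

theorem theoremB:
  fixes G :: "real set" and E :: "'e set" and r :: nat
    and \<nu> :: "('e \<Rightarrow> nat) \<Rightarrow> ereal" and q :: real and k :: nat
  assumes "add_subgroup G"
    and "finite E"
    and "M_convex G E r \<nu>"
    and "0 < q" and "q \<le> 1"
    and "1 \<le> k" and "k < r"
  shows "(I_seq q E r \<nu> k)^2 \<ge>
           (real (k + 1) / real k) * I_seq q E r \<nu> (k + 1) * I_seq q E r \<nu> (k - 1)"
proof -
  have "Delta E r \<noteq> {}" using assms(3) by (auto simp: M_convex_def)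
  \<comment> \<open>Over an empty \<open>E\<close> there is no multi-index of degree
    \<open>r > 0\<close>.\<close>
  then have E: "finite E" "E \<noteq> {}" using assms(2,7) by (auto simp: Delta_def)
  let ?I = "insert None (Some ` E)" and ?a = "\<lambda>\<alpha>. qpow q (\<nu> \<alpha>)"
  \<comment> \<open>This derivative has degree \<open>k + 1\<close>. With zero at
    \<open>None\<close>, \<open>g\<close> completes by \<open>r - (k + 1)\<close> units and each
    further shift adds one, which gives the levels \<open>k + 1\<close>, \<open>k\<close> and
    \<open>k - 1\<close>.\<close>
  define g where "g = (shift None ^^ (r - (k + 1))) (homogenization E ?a)"
  define w :: "'e option \<Rightarrow> real" where "w = case_option 0 (\<lambda>_. 1)"
  obtain d where d: "k = Suc d" using assms(6) by (cases k) auto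
  have "exchange_fun ?I r (homogenization E ?a)"
    by (rule exchange_fun_homogenization[OF E M_convex_exchange_fun[OF E(1) assms(3-5)]])
  moreover have "r - (k + 1) + Suc (Suc d) = r" using assms(7) d by simp
  ultimately have g: "exchange_fun ?I (Suc (Suc d)) g"
    unfolding g_def using E by (intro exchange_fun_funpow_shift) (simp_all only: finite_insert finite_imageI insertI1)
  have I_eq: "genpoly w ?I j c = fact j * I_seq q E r \<nu> j"
    if j: "j \<le> r" and c: "\<And>\<alpha>. c (case_option 0 \<alpha>) = top_value E ?a \<alpha> (r - j)" for j c
  proof -
    have "genpoly w ?I j c = fact j * (\<Sum>\<alpha>\<in>Delta E j. c (case_option 0 \<alpha>) / (\<Prod>e\<in>E. fact (\<alpha> e)))"
      using E by (intro genpoly_eq_sum) (auto simp: w_def)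
    also have "(\<Sum>\<alpha>\<in>Delta E j. c (case_option 0 \<alpha>) / (\<Prod>e\<in>E. fact (\<alpha> e))) = I_seq q E r \<nu> j"
      unfolding I_seq_def using qpow_nu_tilde[OF E assms(3-5) _ j] c by (intro sum.cong) auto
    finally show ?thesis .
  qed
  have hom: "homogenization E ?a ((case_option 0 \<alpha>)(None := n)) = top_value E ?a \<alpha> n" for \<alpha> n
    by (simp add: homogenization_def comp_def)
  have "genpoly w ?I d (shift None (shift None g)) * genpoly w ?I (Suc (Suc d)) g
      \<le> (genpoly w ?I (Suc d) (shift None g))\<^sup>2"
    using E g by (intro genpoly_log_concave_boundary) (auto simp: w_def split: option.split)
  moreover have "genpoly w ?I (Suc (Suc d)) g = fact (Suc (Suc d)) * I_seq q E r \<nu> (Suc (Suc d))"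
    using assms(7) d by (intro I_eq) (simp_all add: g_def funpow_shift hom)
  moreover have "genpoly w ?I (Suc d) (shift None g) = fact (Suc d) * I_seq q E r \<nu> (Suc d)"
    using assms(7) d by (intro I_eq) (simp_all add: g_def funpow_shift inc_def hom Suc_diff_Suc)
  moreover have "genpoly w ?I d (shift None (shift None g)) = fact d * I_seq q E r \<nu> d"
    using assms(7) d by (intro I_eq) (simp_all add: g_def funpow_shift inc_def hom Suc_diff_Suc)
  ultimately have ineq: "fact d * I_seq q E r \<nu> d * (fact (Suc (Suc d)) * I_seq q E r \<nu> (Suc (Suc d)))
      \<le> (fact (Suc d) * I_seq q E r \<nu> (Suc d))\<^sup>2"
    by simp
  \<comment> \<open>Cancelling \<open>F^2 * (d + 1)\<close> from the factorials leaves the ratio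
    \<open>(d + 2) / (d + 1)\<close>, that is \<open>(k + 1) / k\<close>.\<close>
  define F where "F = (fact d :: real)"
  have F: "F > 0" "fact (Suc d) = real (Suc d) * F" "fact (Suc (Suc d)) = real (Suc (Suc d)) * (real (Suc d) * F)"
    by (simp_all add: F_def algebra_simps)
  have "F\<^sup>2 * real (Suc d) * (real (Suc (Suc d)) * I_seq q E r \<nu> (Suc (Suc d)) * I_seq q E r \<nu> d)
      \<le> F\<^sup>2 * real (Suc d) * (real (Suc d) * (I_seq q E r \<nu> (Suc d))\<^sup>2)"
    using ineq unfolding F(2,3) F_def[symmetric] by (simp add: power2_eq_square mult_ac del: of_nat_Suc)
  then have "real (Suc (Suc d)) * I_seq q E r \<nu> (Suc (Suc d)) * I_seq q E r \<nu> d
      \<le> real (Suc d) * (I_seq q E r \<nu> (Suc d))\<^sup>2"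
    using F(1) by (subst (asm) mult_le_cancel_left_pos) (simp_all del: of_nat_Suc)
  then show ?thesis
    unfolding d by (simp add: field_simps)
qed

end
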